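(* Let $H$ be an abelian group with trivial multiplicative Lie algebra structure, let $K$ be a multiplicative Lie algebra, and let $\Gamma : K \to \mathrm{End}(H)$ be a multiplicative Lie algebra homomorphism. Then there is a natural bijective correspondence between the set $CExt_\Gamma(H,K)$ of equivalence classes of center extensions of $H$ by $K$ with given homomorphism $\Gamma$, and the second center cohomology $H^2_{ML(\Gamma)}(K,H)$.
   Context: A multiplicative Lie algebra is a group $(G,\cdot)$ with a binary operation $*$ such that for all $x,y,z\in G$, writing ${}^{x}y = xyx^{-1}$: (1) $x*x=1$; (2) $x*(yz) = (x*y)\,{}^{y}(x*z)$; (3) $(xy)*z = {}^{x}(y*z)\,(x*z)$; (4) $((x*y)*{}^{y}z)\,((y*z)*{}^{z}x)\,((z*x)*{}^{x}y)=1$; (5) ${}^{z}(x*y) = ({}^{z}x)*({}^{z}y)$. Homomorphisms preserve both operations. The structure is trivial if $x*y=1$ for all $x,y$. An ideal is a normal subgroup $I$ with $g*i\in I$ for all $g\in G$, $i\in I$. $\mathrm{End}(H)$ is the set of group endomorphisms of the abelian group $H$ (written multiplicatively), a multiplicative Lie algebra under $(F\cdot G)(a)=F(a)G(a)$ and $(F*G)(a)=F(G(a))\,G(F(a^{-1}))$. Write $\Gamma_x=\Gamma(x)$. An extension of $H$ by $K$ is a short exact sequence $E: 1\to H\to G\xrightarrow{\beta} K\to 1$ of multiplicative Lie algebras; $H$ is regarded as an ideal of $G$. It is a center extension if $H$ is contained in the center of the group $G$. Two extensions of $H$ by $K$ with middle terms $G_1,G_2$ are equivalent if there is a multiplicative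 Lie algebra isomorphism $G_1\to G_2$ inducing the identity on $H$ and on $K$. A section of $E$ is a map $t:K\to G$ with $\beta\circ t=\mathrm{id}_K$ and $t(1)=1$. For a center extension $E$, the homomorphism $\Gamma_E:K\to \mathrm{End}(H)$ is $\Gamma_E(x)(a)=t(x)*a$; it does not depend on the section $t$ nor on the representative of the equivalence class. $CExt_\Gamma(H,K)$ is the set of equivalence classes of center extensions $E$ of $H$ by $K$ with $\Gamma_E=\Gamma$. Given a section $t$, maps $f^t,h^t:K\times K\to H$ are defined by $t(x)t(y)=f^t(x,y)t(xy)$ and $t(x)*t(y)=h^t(x,y)t(x*y)$. A multiplicative center 2-cocycle of $K$ with coefficients in $H$ (with given $\Gamma$) is a triplet $(f,h,\Gamma)$ where $f,h:K\times K\to H$ are maps satisfying for all $x,y,z\in K$: (C1) $f(1,x)=f(x,1)=1$ and $f(x,y)f(xy,z)=f(y,z)f(x,yz)$; (C2) $h(x,x)=h(x,1)=h(1,x)=1$; (C3) $h(x,y)h(x,z)f(y,x*z)f(y^{-1},y)^{-1}f(y(x*z),y^{-1})f(x*y,{}^{y}(x*z))=\Gamma_x(f(y,z))h(x,yz)$; (C4) $h(x,z)h(y,z)f(x,y*z)f(x^{-1},x)^{-1}f(x(y*z),x^{-1})f({}^{x}(y*z),x*z)=\Gamma_z(f(x,y)^{-1})h(xy,z)$; (C5) $\Gamma_x\big(f(z,y)f(z^{-1},z)^{-1}f(zy,z^{-1})\big)\,\Gamma_y\big(f(z,x)^{-1}f(z^{-1},z)f(zx,z^{-1})^{-1}\big)\,h({}^{z}x,{}^{z}y)=h(x,y)f(z,x*y)f(z^{-1},z)^{-1}f(z(x*y),z^{-1})$;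 (C6) $\Gamma_{x*y}\big(f(y,z)f(y^{-1},y)^{-1}f(yz,y^{-1})\big)\,\Gamma_{y*z}\big(f(z,x)f(z^{-1},z)^{-1}f(zx,z^{-1})\big)\,\Gamma_{z*x}\big(f(x,y)f(x^{-1},x)^{-1}f(xy,x^{-1})\big)\,\Gamma_z(h(x,y)^{-1})\,\Gamma_x(h(y,z)^{-1})\,\Gamma_y(h(z,x)^{-1})\,h(x*y,{}^{y}z)\,h(y*z,{}^{z}x)\,h(z*x,{}^{x}y)\,f\big((x*y)*{}^{y}z,(y*z)*{}^{z}x\big)\,f\big(((x*y)*{}^{y}z)((y*z)*{}^{z}x),(z*x)*{}^{x}y\big)=1$. $Z^2_{ML(\Gamma)}(K,H)$ is the abelian group of all such cocycles under $(f,h,\Gamma)\cdot(f',h',\Gamma)=(ff',hh',\Gamma)$. $B^2_{ML(\Gamma)}(K,H)$ is the subgroup of all $(\delta g,g^*,\Gamma)$, where $g:K\to H$ is a map with $g(1)=1$, $\delta g(x,y)=g(x)g(y)g(xy)^{-1}$ and $g^*(x,y)=\Gamma_x(g(y))\Gamma_y(g(x)^{-1})g(x*y)^{-1}$. $H^2_{ML(\Gamma)}(K,H)=Z^2_{ML(\Gamma)}(K,H)/B^2_{ML(\Gamma)}(K,H)$. The natural correspondence meant is the one associating to $[E]$ the class of $(f^t,h^t,\Gamma)$ for a section $t$ of $E$. *)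

theory Defs
  imports "HOL-Algebra.Coset" "HOL-Library.FuncSet"
begin

record 'a mlie = "'a monoid" +
  lie :: "'a \<Rightarrow> 'a \<Rightarrow> 'a"  (infixl \<open>\<star>\<index>\<close> 70)

definition conj_by :: "('a, 'm) monoid_scheme \<Rightarrow> 'a \<Rightarrow> 'a \<Rightarrow> 'a" where
  "conj_by G x y = x \<otimes>\<^bsub>G\<^esub> y \<otimes>\<^bsub>G\<^esub> inv\<^bsub>G\<^esub> x"

locale mult_lie_algebra = group G for G :: "('a, 'm) mlie_scheme" (structure) +
  assumes lie_closed: "\<lbrakk>x \<in> carrier G; y \<in> carrier G\<rbrakk> \<Longrightarrow> x \<star> y \<in> carrier G"
    and lie_self: "x \<in> carrier G \<Longrightarrow> x \<star> x = \<one>"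
    and lie_mult_right: "\<lbrakk>x \<in> carrier G; y \<in> carrier G; z \<in> carrier G\<rbrakk>
      \<Longrightarrow> x \<star> (y \<otimes> z) = (x \<star> y) \<otimes> conj_by G y (x \<star> z)"
    and lie_mult_left: "\<lbrakk>x \<in> carrier G; y \<in> carrier G; z \<in> carrier G\<rbrakk>
      \<Longrightarrow> (x \<otimes> y) \<star> z = conj_by G x (y \<star> z) \<otimes> (x \<star> z)"
    and lie_jacobi: "\<lbrakk>x \<in> carrier G; y \<in> carrier G; z \<in> carrier G\<rbrakk>
      \<Longrightarrow> ((x \<star> y) \<star> conj_by G y z) \<otimes> ((y \<star> z) \<star> conj_by G z x)
            \<otimes> ((z \<star> x) \<star> conj_by G x y) = \<one>"
    and lie_conj: "\<lbrakk>x \<in> carrier G; y \<in> carrier G; z \<in> carrier G\<rbrakk>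
      \<Longrightarrow> conj_by G z (x \<star> y) = conj_by G z x \<star> conj_by G z y"

definition mlie_hom :: "('a, 'm) mlie_scheme \<Rightarrow> ('b, 'n) mlie_scheme \<Rightarrow> ('a \<Rightarrow> 'b) set" where
  "mlie_hom G L = {\<phi> \<in> hom G L.
     \<forall>x \<in> carrier G. \<forall>y \<in> carrier G. \<phi> (x \<star>\<^bsub>G\<^esub> y) = \<phi> x \<star>\<^bsub>L\<^esub> \<phi> y}"

definition mlie_iso :: "('a, 'm) mlie_scheme \<Rightarrow> ('b, 'n) mlie_scheme \<Rightarrow> ('a \<Rightarrow> 'b) set" where
  "mlie_iso G L = {\<phi> \<in> mlie_hom G L. bij_betw \<phi> (carrier G) (carrier L)}"

definition trivial_mlie :: "('a, 'm) mlie_scheme \<Rightarrow> bool" where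
  "trivial_mlie G \<longleftrightarrow> (\<forall>x \<in> carrier G. \<forall>y \<in> carrier G. x \<star>\<^bsub>G\<^esub> y = \<one>\<^bsub>G\<^esub>)"

text \<open>Endomorphisms are taken extensional, so that two of them are equal as soon as they
  agree on the carrier.\<close>

definition End_mlie :: "('h, 'm) monoid_scheme \<Rightarrow> ('h \<Rightarrow> 'h) mlie" where
  "End_mlie H = \<lparr>
     carrier = hom H H \<inter> extensional (carrier H),
     mult = (\<lambda>F G. \<lambda>a \<in> carrier H. F a \<otimes>\<^bsub>H\<^esub> G a),
     one = (\<lambda>a \<in> carrier H. \<one>\<^bsub>H\<^esub>),
     lie = (\<lambda>F G. \<lambda>a \<in> carrier H. F (G a) \<otimes>\<^bsub>H\<^esub> G (F (inv\<^bsub>H\<^esub> a)))\<rparr>"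


section \<open>Extensions\<close>

text \<open>The ideal \<open>H\<close> of the middle term is represented by its embedding \<open>incl\<close>.\<close>

record ('h, 'g, 'k) mlie_extension =
  middle :: "'g mlie"
  incl :: "'h \<Rightarrow> 'g"
  proj :: "'g \<Rightarrow> 'k"

definition is_extension ::
  "('h, 'm) mlie_scheme \<Rightarrow> ('k, 'n) mlie_scheme \<Rightarrow> ('h, 'g, 'k) mlie_extension \<Rightarrow> bool" where
  "is_extension H K E \<longleftrightarrow>
     mult_lie_algebra (middle E) \<and>
     incl E \<in> mlie_hom H (middle E) \<and> inj_on (incl E) (carrier H) \<and>
     proj E \<in> mlie_hom (middle E) K \<and> proj E ` carrier (middle E) = carrier K \<and>
     incl E ` carrier H = kernel (middle E) K (proj E)"

definition is_center_extension ::
  "('h, 'm) mlie_scheme \<Rightarrow> ('k, 'n) mlie_scheme \<Rightarrow> ('h, 'g, 'k) mlie_extension \<Rightarrow> bool" where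
  "is_center_extension H K E \<longleftrightarrow> is_extension H K E \<and>
     (\<forall>a \<in> carrier H. \<forall>g \<in> carrier (middle E).
        incl E a \<otimes>\<^bsub>middle E\<^esub> g = g \<otimes>\<^bsub>middle E\<^esub> incl E a)"

text \<open>The two middle terms may live in different types.\<close>

definition equiv_extension ::
  "('h, 'm) mlie_scheme \<Rightarrow> ('h, 'g1, 'k) mlie_extension \<Rightarrow> ('h, 'g2, 'k) mlie_extension \<Rightarrow> bool" where
  "equiv_extension H E1 E2 \<longleftrightarrow> (\<exists>\<phi> \<in> mlie_iso (middle E1) (middle E2).
     (\<forall>a \<in> carrier H. \<phi> (incl E1 a) = incl E2 a) \<and>
     (\<forall>g \<in> carrier (middle E1). proj E2 (\<phi> g) = proj E1 g))"

definition is_section ::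
  "('k, 'n) mlie_scheme \<Rightarrow> ('h, 'g, 'k) mlie_extension \<Rightarrow> ('k \<Rightarrow> 'g) \<Rightarrow> bool" where
  "is_section K E t \<longleftrightarrow> t \<in> carrier K \<rightarrow> carrier (middle E) \<and>
     (\<forall>x \<in> carrier K. proj E (t x) = x) \<and> t \<one>\<^bsub>K\<^esub> = \<one>\<^bsub>middle E\<^esub>"

definition to_kernel :: "('h, 'm) mlie_scheme \<Rightarrow> ('h, 'g, 'k) mlie_extension \<Rightarrow> 'g \<Rightarrow> 'h" where
  "to_kernel H E = inv_into (carrier H) (incl E)"

definition section_action ::
  "('h, 'm) mlie_scheme \<Rightarrow> ('h, 'g, 'k) mlie_extension \<Rightarrow> ('k \<Rightarrow> 'g) \<Rightarrow> 'k \<Rightarrow> 'h \<Rightarrow> 'h" where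
  "section_action H E t x = (\<lambda>a \<in> carrier H. to_kernel H E (t x \<star>\<^bsub>middle E\<^esub> incl E a))"

text \<open>For a center extension this does not depend on the section that is chosen, see
  \<open>Gamma_ext_eq\<close> below.\<close>

definition Gamma_ext ::
  "('h, 'm) mlie_scheme \<Rightarrow> ('k, 'n) mlie_scheme \<Rightarrow> ('h, 'g, 'k) mlie_extension
     \<Rightarrow> 'k \<Rightarrow> 'h \<Rightarrow> 'h" where
  "Gamma_ext H K E = section_action H E (SOME t. is_section K E t)"

definition center_extensions ::
  "('h, 'm) mlie_scheme \<Rightarrow> ('k, 'n) mlie_scheme \<Rightarrow> ('k \<Rightarrow> 'h \<Rightarrow> 'h)
     \<Rightarrow> ('h, 'g, 'k) mlie_extension set" where
  "center_extensions H K \<Gamma> = {E. is_center_extension H K E \<and>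
     (\<forall>x \<in> carrier K. Gamma_ext H K E x = \<Gamma> x)}"

definition extension_rel ::
  "('h, 'm) mlie_scheme \<Rightarrow> ('k, 'n) mlie_scheme \<Rightarrow> ('k \<Rightarrow> 'h \<Rightarrow> 'h)
     \<Rightarrow> ('h, 'g, 'k) mlie_extension rel" where
  "extension_rel H K \<Gamma> = {(E1, E2). E1 \<in> center_extensions H K \<Gamma> \<and>
     E2 \<in> center_extensions H K \<Gamma> \<and> equiv_extension H E1 E2}"

text \<open>HOL cannot collect middle terms over all types at once. Since the middle term of any
  extension is in bijection with \<open>H \<times> K\<close>, the type \<open>'g = 'h \<times> 'k\<close> is large enough to represent
  every equivalence class.\<close>

definition CExt ::
  "('h, 'm) mlie_scheme \<Rightarrow> ('k, 'n) mlie_scheme \<Rightarrow> ('k \<Rightarrow> 'h \<Rightarrow> 'h)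
     \<Rightarrow> ('h, 'g, 'k) mlie_extension set set" where
  "CExt H K \<Gamma> = center_extensions H K \<Gamma> // extension_rel H K \<Gamma>"

lemma section_exists:
  assumes "is_extension H K E" and "group K"
  shows "\<exists>t. is_section K E t"
proof -
  interpret M: mult_lie_algebra "middle E" using assms by (simp add: is_extension_def)
  interpret K: group K by fact
  have img: "proj E ` carrier (middle E) = carrier K"
    and hom: "proj E \<in> hom (middle E) K"
    using assms by (auto simp: is_extension_def mlie_hom_def)
  define t where "t x = (if x = \<one>\<^bsub>K\<^esub> then \<one>\<^bsub>middle E\<^esub>
    else inv_into (carrier (middle E)) (proj E) x)" for x
  have "proj E \<one>\<^bsub>middle E\<^esub> = \<one>\<^bsub>K\<^esub>"
    using hom_one[OF hom M.is_group K.is_group] .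
  then have "is_section K E t"
    unfolding is_section_def t_def
    by (auto simp: img inv_into_into f_inv_into_f)
  then show ?thesis by blast
qed

lemma Gamma_ext_eq:
  assumes E: "is_center_extension H K E" and K: "group K" and H: "group H"
    and triv: "trivial_mlie H" and t: "is_section K E t" and x: "x \<in> carrier K"
  shows "Gamma_ext H K E x = section_action H E t x"
proof -
  define s where "s = (SOME t. is_section K E t)"
  have ext: "is_extension H K E" using E by (simp add: is_center_extension_def)
  interpret M: mult_lie_algebra "middle E" using ext by (simp add: is_extension_def)
  interpret K: group K by fact
  interpret H: group H by fact
  have s: "is_section K E s" unfolding s_def using section_exists[OF ext K] by (rule someI_ex)
  let ?G = "middle E"
  have hp: "proj E \<in> hom ?G K" and hi: "incl E \<in> hom H ?G"
    and il: "\<And>a b. \<lbrakk>a \<in> carrier H; b \<in> carrier H\<rbrakk>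
      \<Longrightarrow> incl E (a \<star>\<^bsub>H\<^esub> b) = incl E a \<star>\<^bsub>?G\<^esub> incl E b"
    and pl: "\<And>a b. \<lbrakk>a \<in> carrier ?G; b \<in> carrier ?G\<rbrakk>
      \<Longrightarrow> proj E (a \<star>\<^bsub>?G\<^esub> b) = proj E a \<star>\<^bsub>K\<^esub> proj E b"
    and ker: "incl E ` carrier H = kernel ?G K (proj E)"
    using ext by (auto simp: is_extension_def mlie_hom_def)
  interpret P: group_hom ?G K "proj E" by unfold_locales (rule hp)
  have sx: "s x \<in> carrier ?G" "proj E (s x) = x" and tx: "t x \<in> carrier ?G" "proj E (t x) = x"
    using s t x by (auto simp: is_section_def)
  have "s x \<otimes>\<^bsub>?G\<^esub> inv\<^bsub>?G\<^esub> t x \<in> kernel ?G K (proj E)"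
    using sx tx x by (simp add: kernel_def)
  then obtain c where c: "c \<in> carrier H" "incl E c = s x \<otimes>\<^bsub>?G\<^esub> inv\<^bsub>?G\<^esub> t x"
    using ker by (metis imageE)
  have ic: "incl E c \<in> carrier ?G" using c sx tx by simp
  have seq: "s x = incl E c \<otimes>\<^bsub>?G\<^esub> t x" using c sx tx by (simp add: M.m_assoc)
  have "s x \<star>\<^bsub>?G\<^esub> incl E a = t x \<star>\<^bsub>?G\<^esub> incl E a" if a: "a \<in> carrier H" for a
  proof -
    have ia: "incl E a \<in> carrier ?G" using hi a by (auto simp: hom_def)
    have ta: "t x \<star>\<^bsub>?G\<^esub> incl E a \<in> carrier ?G" using tx ia M.lie_closed by simp
    have "incl E c \<star>\<^bsub>?G\<^esub> incl E a = \<one>\<^bsub>?G\<^esub>"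
      using il[OF c(1) a] triv c a hom_one[OF hi H.is_group M.is_group]
      by (simp add: trivial_mlie_def)
    moreover have "conj_by ?G (incl E c) (t x \<star>\<^bsub>?G\<^esub> incl E a) = t x \<star>\<^bsub>?G\<^esub> incl E a"
    proof -
      have "incl E c \<otimes>\<^bsub>?G\<^esub> (t x \<star>\<^bsub>?G\<^esub> incl E a) = (t x \<star>\<^bsub>?G\<^esub> incl E a) \<otimes>\<^bsub>?G\<^esub> incl E c"
        using E c(1) ta by (simp add: is_center_extension_def)
      then show ?thesis unfolding conj_by_def using ic ta by (simp add: M.m_assoc)
    qed
    ultimately show ?thesis
      using M.lie_mult_left[OF ic tx(1) ia] seq ta by simp
  qed
  then show ?thesis
    unfolding Gamma_ext_def s_def[symmetric] section_action_def by (auto intro!: restrict_ext)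
qed


section \<open>Cocycles\<close>

text \<open>As for endomorphisms, maps \<open>K \<times> K \<rightarrow> H\<close> are extensional functions on pairs of elements
  of the carrier.\<close>

definition section_f ::
  "('h, 'm) mlie_scheme \<Rightarrow> ('k, 'n) mlie_scheme \<Rightarrow> ('h, 'g, 'k) mlie_extension
     \<Rightarrow> ('k \<Rightarrow> 'g) \<Rightarrow> 'k \<times> 'k \<Rightarrow> 'h" where
  "section_f H K E t = (\<lambda>(x, y) \<in> carrier K \<times> carrier K. to_kernel H E
     (t x \<otimes>\<^bsub>middle E\<^esub> t y \<otimes>\<^bsub>middle E\<^esub> inv\<^bsub>middle E\<^esub> t (x \<otimes>\<^bsub>K\<^esub> y)))"

definition section_h ::
  "('h, 'm) mlie_scheme \<Rightarrow> ('k, 'n) mlie_scheme \<Rightarrow> ('h, 'g, 'k) mlie_extension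
     \<Rightarrow> ('k \<Rightarrow> 'g) \<Rightarrow> 'k \<times> 'k \<Rightarrow> 'h" where
  "section_h H K E t = (\<lambda>(x, y) \<in> carrier K \<times> carrier K. to_kernel H E
     ((t x \<star>\<^bsub>middle E\<^esub> t y) \<otimes>\<^bsub>middle E\<^esub> inv\<^bsub>middle E\<^esub> t (x \<star>\<^bsub>K\<^esub> y)))"

type_synonym ('h, 'k) triplet = "('k \<times> 'k \<Rightarrow> 'h) \<times> ('k \<times> 'k \<Rightarrow> 'h) \<times> ('k \<Rightarrow> 'h \<Rightarrow> 'h)"

text \<open>The conditions are the multiplicative Lie algebra laws for \<open>t x\<close>, \<open>t y\<close>, \<open>t z\<close> read off in \<open>H\<close>.
  The recurring factor \<open>f (y, u) inv (f (inv y, y)) f (y u, inv y)\<close> is the discrepancy between the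
  conjugate of \<open>t u\<close> by \<open>t y\<close> and \<open>t\<close> of the conjugate of \<open>u\<close> by \<open>y\<close>.\<close>

definition is_cocycle ::
  "('h, 'm) mlie_scheme \<Rightarrow> ('k, 'n) mlie_scheme \<Rightarrow> ('h, 'k) triplet \<Rightarrow> bool" where
  "is_cocycle H K = (\<lambda>(f, h, \<Gamma>).
     f \<in> carrier K \<times> carrier K \<rightarrow>\<^sub>E carrier H \<and>
     h \<in> carrier K \<times> carrier K \<rightarrow>\<^sub>E carrier H \<and>
     (\<forall>x \<in> carrier K. \<forall>y \<in> carrier K. \<forall>z \<in> carrier K.
       (f (\<one>\<^bsub>K\<^esub>, x) = \<one>\<^bsub>H\<^esub> \<and> f (x, \<one>\<^bsub>K\<^esub>) = \<one>\<^bsub>H\<^esub> \<and>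
         f (x, y) \<otimes>\<^bsub>H\<^esub> f (x \<otimes>\<^bsub>K\<^esub> y, z) = f (y, z) \<otimes>\<^bsub>H\<^esub> f (x, y \<otimes>\<^bsub>K\<^esub> z)) \<and>
       (h (x, x) = \<one>\<^bsub>H\<^esub> \<and> h (x, \<one>\<^bsub>K\<^esub>) = \<one>\<^bsub>H\<^esub> \<and> h (\<one>\<^bsub>K\<^esub>, x) = \<one>\<^bsub>H\<^esub>) \<and>
       (h (x, y) \<otimes>\<^bsub>H\<^esub> h (x, z) \<otimes>\<^bsub>H\<^esub>
         f (y, x \<star>\<^bsub>K\<^esub> z) \<otimes>\<^bsub>H\<^esub> inv\<^bsub>H\<^esub> (f (inv\<^bsub>K\<^esub> y, y)) \<otimes>\<^bsub>H\<^esub> f (y \<otimes>\<^bsub>K\<^esub> (x \<star>\<^bsub>K\<^esub> z), inv\<^bsub>K\<^esub> y) \<otimes>\<^bsub>H\<^esub>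
         f (x \<star>\<^bsub>K\<^esub> y, conj_by K y (x \<star>\<^bsub>K\<^esub> z))
         = \<Gamma> x (f (y, z)) \<otimes>\<^bsub>H\<^esub> h (x, y \<otimes>\<^bsub>K\<^esub> z)) \<and>
       (h (x, z) \<otimes>\<^bsub>H\<^esub> h (y, z) \<otimes>\<^bsub>H\<^esub>
         f (x, y \<star>\<^bsub>K\<^esub> z) \<otimes>\<^bsub>H\<^esub> inv\<^bsub>H\<^esub> (f (inv\<^bsub>K\<^esub> x, x)) \<otimes>\<^bsub>H\<^esub> f (x \<otimes>\<^bsub>K\<^esub> (y \<star>\<^bsub>K\<^esub> z), inv\<^bsub>K\<^esub> x) \<otimes>\<^bsub>H\<^esub>
         f (conj_by K x (y \<star>\<^bsub>K\<^esub> z), x \<star>\<^bsub>K\<^esub> z)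
         = \<Gamma> z (inv\<^bsub>H\<^esub> (f (x, y))) \<otimes>\<^bsub>H\<^esub> h (x \<otimes>\<^bsub>K\<^esub> y, z)) \<and>
       (\<Gamma> x (f (z, y) \<otimes>\<^bsub>H\<^esub> inv\<^bsub>H\<^esub> (f (inv\<^bsub>K\<^esub> z, z)) \<otimes>\<^bsub>H\<^esub> f (z \<otimes>\<^bsub>K\<^esub> y, inv\<^bsub>K\<^esub> z)) \<otimes>\<^bsub>H\<^esub>
         \<Gamma> y (inv\<^bsub>H\<^esub> (f (z, x)) \<otimes>\<^bsub>H\<^esub> f (inv\<^bsub>K\<^esub> z, z) \<otimes>\<^bsub>H\<^esub> inv\<^bsub>H\<^esub> (f (z \<otimes>\<^bsub>K\<^esub> x, inv\<^bsub>K\<^esub> z))) \<otimes>\<^bsub>H\<^esub>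
         h (conj_by K z x, conj_by K z y)
         = h (x, y) \<otimes>\<^bsub>H\<^esub> f (z, x \<star>\<^bsub>K\<^esub> y) \<otimes>\<^bsub>H\<^esub> inv\<^bsub>H\<^esub> (f (inv\<^bsub>K\<^esub> z, z)) \<otimes>\<^bsub>H\<^esub> f (z \<otimes>\<^bsub>K\<^esub> (x \<star>\<^bsub>K\<^esub> y), inv\<^bsub>K\<^esub> z)) \<and>
       (\<Gamma> (x \<star>\<^bsub>K\<^esub> y) (f (y, z) \<otimes>\<^bsub>H\<^esub> inv\<^bsub>H\<^esub> (f (inv\<^bsub>K\<^esub> y, y)) \<otimes>\<^bsub>H\<^esub> f (y \<otimes>\<^bsub>K\<^esub> z, inv\<^bsub>K\<^esub> y)) \<otimes>\<^bsub>H\<^esub>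
         \<Gamma> (y \<star>\<^bsub>K\<^esub> z) (f (z, x) \<otimes>\<^bsub>H\<^esub> inv\<^bsub>H\<^esub> (f (inv\<^bsub>K\<^esub> z, z)) \<otimes>\<^bsub>H\<^esub> f (z \<otimes>\<^bsub>K\<^esub> x, inv\<^bsub>K\<^esub> z)) \<otimes>\<^bsub>H\<^esub>
         \<Gamma> (z \<star>\<^bsub>K\<^esub> x) (f (x, y) \<otimes>\<^bsub>H\<^esub> inv\<^bsub>H\<^esub> (f (inv\<^bsub>K\<^esub> x, x)) \<otimes>\<^bsub>H\<^esub> f (x \<otimes>\<^bsub>K\<^esub> y, inv\<^bsub>K\<^esub> x)) \<otimes>\<^bsub>H\<^esub>
         \<Gamma> z (inv\<^bsub>H\<^esub> (h (x, y))) \<otimes>\<^bsub>H\<^esub> \<Gamma> x (inv\<^bsub>H\<^esub> (h (y, z))) \<otimes>\<^bsub>H\<^esub> \<Gamma> y (inv\<^bsub>H\<^esub> (h (z, x))) \<otimes>\<^bsub>H\<^esub>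
         h (x \<star>\<^bsub>K\<^esub> y, conj_by K y z) \<otimes>\<^bsub>H\<^esub> h (y \<star>\<^bsub>K\<^esub> z, conj_by K z x) \<otimes>\<^bsub>H\<^esub> h (z \<star>\<^bsub>K\<^esub> x, conj_by K x y) \<otimes>\<^bsub>H\<^esub>
         f ((x \<star>\<^bsub>K\<^esub> y) \<star>\<^bsub>K\<^esub> (conj_by K y z), (y \<star>\<^bsub>K\<^esub> z) \<star>\<^bsub>K\<^esub> (conj_by K z x)) \<otimes>\<^bsub>H\<^esub>
         f (((x \<star>\<^bsub>K\<^esub> y) \<star>\<^bsub>K\<^esub> (conj_by K y z)) \<otimes>\<^bsub>K\<^esub> ((y \<star>\<^bsub>K\<^esub> z) \<star>\<^bsub>K\<^esub> (conj_by K z x)), (z \<star>\<^bsub>K\<^esub> x) \<star>\<^bsub>K\<^esub> (conj_by K x y))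
         = \<one>\<^bsub>H\<^esub>)))"

definition Z2 ::
  "('h, 'm) mlie_scheme \<Rightarrow> ('k, 'n) mlie_scheme \<Rightarrow> ('k \<Rightarrow> 'h \<Rightarrow> 'h) \<Rightarrow> ('h, 'k) triplet monoid" where
  "Z2 H K \<Gamma> = \<lparr>
     carrier = {(f, h, \<Gamma>) | f h. is_cocycle H K (f, h, \<Gamma>)},
     mult = (\<lambda>(f, h, _) (f', h', _).
       ((\<lambda>p \<in> carrier K \<times> carrier K. f p \<otimes>\<^bsub>H\<^esub> f' p),
        (\<lambda>p \<in> carrier K \<times> carrier K. h p \<otimes>\<^bsub>H\<^esub> h' p), \<Gamma>)),
     one = ((\<lambda>p \<in> carrier K \<times> carrier K. \<one>\<^bsub>H\<^esub>), (\<lambda>p \<in> carrier K \<times> carrier K. \<one>\<^bsub>H\<^esub>), \<Gamma>)\<rparr>"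

definition coboundary_f ::
  "('h, 'm) mlie_scheme \<Rightarrow> ('k, 'n) mlie_scheme \<Rightarrow> ('k \<Rightarrow> 'h) \<Rightarrow> 'k \<times> 'k \<Rightarrow> 'h" where
  "coboundary_f H K g = (\<lambda>(x, y) \<in> carrier K \<times> carrier K.
     g x \<otimes>\<^bsub>H\<^esub> g y \<otimes>\<^bsub>H\<^esub> inv\<^bsub>H\<^esub> (g (x \<otimes>\<^bsub>K\<^esub> y)))"

definition coboundary_h ::
  "('h, 'm) mlie_scheme \<Rightarrow> ('k, 'n) mlie_scheme \<Rightarrow> ('k \<Rightarrow> 'h \<Rightarrow> 'h) \<Rightarrow> ('k \<Rightarrow> 'h)
     \<Rightarrow> 'k \<times> 'k \<Rightarrow> 'h" where
  "coboundary_h H K \<Gamma> g = (\<lambda>(x, y) \<in> carrier K \<times> carrier K.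
     \<Gamma> x (g y) \<otimes>\<^bsub>H\<^esub> \<Gamma> y (inv\<^bsub>H\<^esub> (g x)) \<otimes>\<^bsub>H\<^esub> inv\<^bsub>H\<^esub> (g (x \<star>\<^bsub>K\<^esub> y)))"

definition B2 ::
  "('h, 'm) mlie_scheme \<Rightarrow> ('k, 'n) mlie_scheme \<Rightarrow> ('k \<Rightarrow> 'h \<Rightarrow> 'h) \<Rightarrow> ('h, 'k) triplet set" where
  "B2 H K \<Gamma> = {(coboundary_f H K g, coboundary_h H K \<Gamma> g, \<Gamma>) | g.
     g \<in> carrier K \<rightarrow> carrier H \<and> g \<one>\<^bsub>K\<^esub> = \<one>\<^bsub>H\<^esub>}"

definition H2 ::
  "('h, 'm) mlie_scheme \<Rightarrow> ('k, 'n) mlie_scheme \<Rightarrow> ('k \<Rightarrow> 'h \<Rightarrow> 'h)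
     \<Rightarrow> ('h, 'k) triplet set monoid" where
  "H2 H K \<Gamma> = Z2 H K \<Gamma> Mod B2 H K \<Gamma>"

definition section_class ::
  "('h, 'm) mlie_scheme \<Rightarrow> ('k, 'n) mlie_scheme \<Rightarrow> ('k \<Rightarrow> 'h \<Rightarrow> 'h)
     \<Rightarrow> ('h, 'g, 'k) mlie_extension \<Rightarrow> ('k \<Rightarrow> 'g) \<Rightarrow> ('h, 'k) triplet set" where
  "section_class H K \<Gamma> E t = B2 H K \<Gamma> #>\<^bsub>Z2 H K \<Gamma>\<^esub> (section_f H K E t, section_h H K E t, \<Gamma>)"

end

(* A section t identifies the middle term of a center extension with H x K through
   (a, x) |-> a t(x), and both operations become explicit:
     (a, x) (b, y) = (a b f(x, y), x y),
     (a, x) * (b, y) = (Gamma_x(b) Gamma_y(a)^-1 h(x, y), x * y).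
   With these operations H x K satisfies the laws of a multiplicative Lie algebra exactly when
   (f, h, Gamma) is a cocycle: each law, read on elements (1, x), is one of the conditions, and the
   terms contributed by the H-components cancel because Gamma is a homomorphism. So sections yield
   cocycles, and cocycles yield extensions. Replacing t by x |-> g(x) t(x) multiplies the cocycle by
   the coboundary of g, and an equivalence carries sections to sections with the same cocycle. *)

theory Submission
  imports Defs
begin

text \<open>The factor \<open>\<Gamma> y (inv a)\<close> in the bracket is forced: every
  multiplicative Lie bracket is antisymmetric up to inversion, so the bracket of \<open>a\<close>
  with \<open>t y\<close> is the inverse of that of \<open>t y\<close> with \<open>a\<close>.

  The cocycle conditions are never computed inside the middle term of an extension. The bijection
  with H x K pulls the laws back to H x K, where product, inverse, conjugation and bracket are
  closed formulas. Laws and conditions are therefore compared only there, for arbitrary cochains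
  with normalized \<open>f\<close>, and the comparison serves both directions.

  Most laws see only the group homomorphism \<Gamma> into the abelian group End(H). The Jacobi law
  is the place where \<Gamma> must respect the bracket: each H-component enters through \<Gamma> of
  a bracket and through both orders of composition, and these three terms cancel.

  Cosets of coboundaries are treated as orbits of the normalized maps g, so that comparing classes
  is a pointwise calculation in H. The class of an extension lives in a type independent of its
  middle term; this lets extensions over different types be compared.\<close>

definition twisted_mlie ::
  "('h, 'm) mlie_scheme \<Rightarrow> ('k, 'n) mlie_scheme \<Rightarrow> ('h, 'k) triplet \<Rightarrow> ('h \<times> 'k) mlie" where
  "twisted_mlie H K = (\<lambda>(f, h, \<Gamma>). \<lparr>
     carrier = carrier H \<times> carrier K,
     mult = (\<lambda>(a, x) (b, y). (a \<otimes>\<^bsub>H\<^esub> b \<otimes>\<^bsub>H\<^esub> f (x, y), x \<otimes>\<^bsub>K\<^esub> y)),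
     one = (\<one>\<^bsub>H\<^esub>, \<one>\<^bsub>K\<^esub>),
     lie = (\<lambda>(a, x) (b, y). (\<Gamma> x b \<otimes>\<^bsub>H\<^esub> \<Gamma> y (inv\<^bsub>H\<^esub> a) \<otimes>\<^bsub>H\<^esub> h (x, y), x \<star>\<^bsub>K\<^esub> y))\<rparr>)"

definition twisted_extension ::
  "('h, 'm) mlie_scheme \<Rightarrow> ('k, 'n) mlie_scheme \<Rightarrow> ('h, 'k) triplet
     \<Rightarrow> ('h, 'h \<times> 'k, 'k) mlie_extension" where
  "twisted_extension H K c =
     \<lparr>middle = twisted_mlie H K c, incl = (\<lambda>a. (a, \<one>\<^bsub>K\<^esub>)), proj = snd\<rparr>"

section \<open>Elementary consequences of the multiplicative Lie laws\<close>

context mult_lie_algebra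
begin

lemma conj_by_closed [simp]:
  "\<lbrakk>x \<in> carrier G; y \<in> carrier G\<rbrakk> \<Longrightarrow> conj_by G x y \<in> carrier G"
  by (simp add: conj_by_def)

lemma conj_by_mult:
  "\<lbrakk>x \<in> carrier G; y \<in> carrier G; z \<in> carrier G\<rbrakk>
    \<Longrightarrow> conj_by G x (y \<otimes> z) = conj_by G x y \<otimes> conj_by G x z"
  by (simp add: conj_by_def m_assoc inv_solve_left)

lemma conj_by_one_left [simp]: "x \<in> carrier G \<Longrightarrow> conj_by G \<one> x = x"
  by (simp add: conj_by_def)

lemma conj_by_commuting:
  "\<lbrakk>x \<in> carrier G; y \<in> carrier G; x \<otimes> y = y \<otimes> x\<rbrakk> \<Longrightarrow> conj_by G x y = y"
  by (simp add: conj_by_def m_assoc)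

lemma conj_by_eq_one:
  "\<lbrakk>x \<in> carrier G; y \<in> carrier G; conj_by G x y = \<one>\<rbrakk> \<Longrightarrow> y = \<one>"
  by (metis conj_by_def inv_closed l_one m_closed r_inv m_assoc inv_equality r_cancel_one)

declare lie_closed [simp]

lemma lie_one_right [simp]: "x \<in> carrier G \<Longrightarrow> x \<star> \<one> = \<one>"
  using lie_mult_right[of x \<one> \<one>] by (simp add: r_cancel_one')

lemma lie_one_left [simp]: "x \<in> carrier G \<Longrightarrow> \<one> \<star> x = \<one>"
  using lie_mult_left[of \<one> \<one> x] by (simp add: r_cancel_one')

text \<open>Expand the trivial bracket of \<open>x \<otimes> y\<close> with itself by both
  distributive laws. The brackets of \<open>x\<close> with \<open>x\<close> and of \<open>y\<close>
  with \<open>y\<close> disappear, and the conjugate by \<open>x\<close> of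
  \<open>(y \<star> x) \<otimes> (x \<star> y)\<close> remains.\<close>

lemma lie_antisym:
  assumes x: "x \<in> carrier G" and y: "y \<in> carrier G"
  shows "y \<star> x = inv (x \<star> y)"
proof -
  have "\<one> = (x \<otimes> y) \<star> (x \<otimes> y)"
    using x y by (simp add: lie_self)
  also have "\<dots> = conj_by G x (y \<star> (x \<otimes> y)) \<otimes> (x \<star> (x \<otimes> y))"
    using x y by (simp add: lie_mult_left)
  also have "\<dots> = conj_by G x (y \<star> x) \<otimes> conj_by G x (x \<star> y)"
    using x y by (simp add: lie_mult_right lie_self conj_by_def[of G x \<one>])
  also have "\<dots> = conj_by G x ((y \<star> x) \<otimes> (x \<star> y))"
    using x y by (simp add: conj_by_mult)
  finally have "(y \<star> x) \<otimes> (x \<star> y) = \<one>"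
    using conj_by_eq_one[of x "(y \<star> x) \<otimes> (x \<star> y)"] x y by simp
  then show ?thesis
    using x y by (simp add: inv_equality)
qed

end

section \<open>The homomorphism \<Gamma> as an action of K on H\<close>

locale center_data = H: comm_group H + K: mult_lie_algebra K
  for H :: "('h, 'm) mlie_scheme" and K :: "('k, 'n) mlie_scheme" +
  fixes \<Gamma> :: "'k \<Rightarrow> 'h \<Rightarrow> 'h"
  assumes trivial: "trivial_mlie H"
    and \<Gamma>_hom: "\<Gamma> \<in> mlie_hom K (End_mlie H)"
begin

lemma \<Gamma>_extensional: "x \<in> carrier K \<Longrightarrow> \<Gamma> x \<in> extensional (carrier H)"
  using \<Gamma>_hom by (auto simp: mlie_hom_def hom_def End_mlie_def)

lemma \<Gamma>_closed [simp]: "\<lbrakk>x \<in> carrier K; a \<in> carrier H\<rbrakk> \<Longrightarrow> \<Gamma> x a \<in> carrier H"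
  using \<Gamma>_hom by (auto simp: mlie_hom_def hom_def End_mlie_def)

lemma \<Gamma>_mult_arg [simp]:
  "\<lbrakk>x \<in> carrier K; a \<in> carrier H; b \<in> carrier H\<rbrakk> \<Longrightarrow> \<Gamma> x (a \<otimes>\<^bsub>H\<^esub> b) = \<Gamma> x a \<otimes>\<^bsub>H\<^esub> \<Gamma> x b"
  using \<Gamma>_hom by (auto simp: mlie_hom_def hom_def End_mlie_def Pi_iff)

lemma group_hom_\<Gamma>: "x \<in> carrier K \<Longrightarrow> group_hom H H (\<Gamma> x)"
  by unfold_locales (simp add: hom_def)

lemma \<Gamma>_one_arg [simp]: "x \<in> carrier K \<Longrightarrow> \<Gamma> x \<one>\<^bsub>H\<^esub> = \<one>\<^bsub>H\<^esub>"
  by (rule group_hom.hom_one[OF group_hom_\<Gamma>])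

lemma \<Gamma>_inv_arg [simp]:
  "\<lbrakk>x \<in> carrier K; a \<in> carrier H\<rbrakk> \<Longrightarrow> \<Gamma> x (inv\<^bsub>H\<^esub> a) = inv\<^bsub>H\<^esub> (\<Gamma> x a)"
  by (rule group_hom.hom_inv[OF group_hom_\<Gamma>])

lemma \<Gamma>_mult [simp]:
  "\<lbrakk>x \<in> carrier K; y \<in> carrier K; a \<in> carrier H\<rbrakk> \<Longrightarrow> \<Gamma> (x \<otimes>\<^bsub>K\<^esub> y) a = \<Gamma> x a \<otimes>\<^bsub>H\<^esub> \<Gamma> y a"
  using \<Gamma>_hom by (simp add: mlie_hom_def hom_def End_mlie_def)

lemma \<Gamma>_lie:
  "\<lbrakk>x \<in> carrier K; y \<in> carrier K; a \<in> carrier H\<rbrakk>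
    \<Longrightarrow> \<Gamma> (x \<star>\<^bsub>K\<^esub> y) a = \<Gamma> x (\<Gamma> y a) \<otimes>\<^bsub>H\<^esub> inv\<^bsub>H\<^esub> (\<Gamma> y (\<Gamma> x a))"
  using \<Gamma>_hom by (simp add: mlie_hom_def End_mlie_def)

lemma \<Gamma>_one [simp]: "a \<in> carrier H \<Longrightarrow> \<Gamma> \<one>\<^bsub>K\<^esub> a = \<one>\<^bsub>H\<^esub>"
  using \<Gamma>_mult[of "\<one>\<^bsub>K\<^esub>" "\<one>\<^bsub>K\<^esub>" a] by (simp add: H.r_cancel_one')

lemma \<Gamma>_inv [simp]:
  "\<lbrakk>x \<in> carrier K; a \<in> carrier H\<rbrakk> \<Longrightarrow> \<Gamma> (inv\<^bsub>K\<^esub> x) a = inv\<^bsub>H\<^esub> (\<Gamma> x a)"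
  using \<Gamma>_mult[of "inv\<^bsub>K\<^esub> x" x a] by (simp add: H.inv_equality)

text \<open>Pointwise multiplication makes End(H) abelian, so \<Gamma> cannot see conjugation. This
  lets the \<Gamma>-terms on conjugated arguments in the conjugation and Jacobi laws match those on
  the original arguments.\<close>

lemma \<Gamma>_conj [simp]:
  assumes "x \<in> carrier K" "y \<in> carrier K" "a \<in> carrier H"
  shows "\<Gamma> (conj_by K x y) a = \<Gamma> y a"
  using assms by (simp add: conj_by_def H.m_comm[of "\<Gamma> x a"] H.m_assoc)

end

section \<open>The twisted operations on H x K and the cocycle conditions\<close>

text \<open>Only the typing and the unit conditions on \<open>f\<close> are assumed, so that both
  implications between the laws of \<open>G\<close> and the cocycle conditions can be stated. The
  unit conditions on \<open>h\<close> are obtained in each direction from what is assumed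
  there.\<close>

locale normalized_cochain = center_data H K \<Gamma>
  for H :: "('h, 'm) mlie_scheme" and K :: "('k, 'n) mlie_scheme" and \<Gamma> +
  fixes f h
  assumes f_type: "f \<in> carrier K \<times> carrier K \<rightarrow>\<^sub>E carrier H"
    and h_type: "h \<in> carrier K \<times> carrier K \<rightarrow>\<^sub>E carrier H"
    and f_one_left [simp]: "x \<in> carrier K \<Longrightarrow> f (\<one>\<^bsub>K\<^esub>, x) = \<one>\<^bsub>H\<^esub>"
    and f_one_right [simp]: "x \<in> carrier K \<Longrightarrow> f (x, \<one>\<^bsub>K\<^esub>) = \<one>\<^bsub>H\<^esub>"
begin

abbreviation G where "G \<equiv> twisted_mlie H K (f, h, \<Gamma>)"

lemma f_closed [simp]: "\<lbrakk>x \<in> carrier K; y \<in> carrier K\<rbrakk> \<Longrightarrow> f (x, y) \<in> carrier H"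
  using f_type by auto

lemma h_closed [simp]: "\<lbrakk>x \<in> carrier K; y \<in> carrier K\<rbrakk> \<Longrightarrow> h (x, y) \<in> carrier H"
  using h_type by auto

lemma twisted_simps [simp]:
  "carrier G = carrier H \<times> carrier K"
  "\<one>\<^bsub>G\<^esub> = (\<one>\<^bsub>H\<^esub>, \<one>\<^bsub>K\<^esub>)"
  "(a, x) \<otimes>\<^bsub>G\<^esub> (b, y) = (a \<otimes>\<^bsub>H\<^esub> b \<otimes>\<^bsub>H\<^esub> f (x, y), x \<otimes>\<^bsub>K\<^esub> y)"
  "(a, x) \<star>\<^bsub>G\<^esub> (b, y) = (\<Gamma> x b \<otimes>\<^bsub>H\<^esub> \<Gamma> y (inv\<^bsub>H\<^esub> a) \<otimes>\<^bsub>H\<^esub> h (x, y), x \<star>\<^bsub>K\<^esub> y)"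
  by (simp_all add: twisted_mlie_def)

text \<open>The recurring factor of the cocycle conditions under a name of its own. Treated as a
  single element of H, it keeps the longer identities to a mere reordering of factors.\<close>

definition conj_defect :: "'k \<Rightarrow> 'k \<Rightarrow> 'h" where
  "conj_defect y u = f (y, u) \<otimes>\<^bsub>H\<^esub> inv\<^bsub>H\<^esub> (f (inv\<^bsub>K\<^esub> y, y)) \<otimes>\<^bsub>H\<^esub> f (y \<otimes>\<^bsub>K\<^esub> u, inv\<^bsub>K\<^esub> y)"

lemma conj_defect_closed [simp]:
  "\<lbrakk>y \<in> carrier K; u \<in> carrier K\<rbrakk> \<Longrightarrow> conj_defect y u \<in> carrier H"
  by (simp add: conj_defect_def)

text \<open>Needs no associativity, so it can supply the inverses in the proof that \<open>G\<close>
  is a group and also identify them once that is known. The factor \<open>inv (f (inv x, x))\<close>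
  undoes the twist of the product.\<close>

lemma twisted_left_inv:
  "\<lbrakk>a \<in> carrier H; x \<in> carrier K\<rbrakk> \<Longrightarrow>
     (inv\<^bsub>H\<^esub> a \<otimes>\<^bsub>H\<^esub> inv\<^bsub>H\<^esub> (f (inv\<^bsub>K\<^esub> x, x)), inv\<^bsub>K\<^esub> x) \<otimes>\<^bsub>G\<^esub> (a, x) = \<one>\<^bsub>G\<^esub>"
  by (simp add: H.m_ac)

text \<open>Since H is abelian and \<open>f\<close> and the K-part do not act on it, the component
  \<open>b\<close> cancels against its inverse; only \<open>y\<close> influences the
  conjugation.\<close>

lemma conj_twisted:
  assumes "group G" "b \<in> carrier H" "y \<in> carrier K" "c \<in> carrier H" "u \<in> carrier K"
  shows "conj_by G (b, y) (c, u) = (c \<otimes>\<^bsub>H\<^esub> conj_defect y u, conj_by K y u)"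
proof -
  interpret G: group G by fact
  have inv: "inv\<^bsub>G\<^esub> (b, y) = (inv\<^bsub>H\<^esub> b \<otimes>\<^bsub>H\<^esub> inv\<^bsub>H\<^esub> (f (inv\<^bsub>K\<^esub> y, y)), inv\<^bsub>K\<^esub> y)"
    by (rule G.inv_equality[OF twisted_left_inv]) (use assms in auto)
  have cancel: "b \<otimes>\<^bsub>H\<^esub> (c \<otimes>\<^bsub>H\<^esub> (inv\<^bsub>H\<^esub> b \<otimes>\<^bsub>H\<^esub> d)) = c \<otimes>\<^bsub>H\<^esub> d" if "d \<in> carrier H" for d
    using that assms H.m_lcomm[of b c "inv\<^bsub>H\<^esub> b \<otimes>\<^bsub>H\<^esub> d"] by (simp flip: H.m_assoc[of b "inv\<^bsub>H\<^esub> b"])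
  show ?thesis
    using assms by (simp add: inv cancel conj_by_def[of G] conj_by_def[of K] conj_defect_def H.m_ac)
qed

text \<open>The H-components of three factors occur in the same way under both bracketings and
  cancel. What is left of associativity is the identity for \<open>f\<close>; units and left
  inverses come from its normalization.\<close>

lemma group_twisted_iff:
  "group G \<longleftrightarrow> (\<forall>x \<in> carrier K. \<forall>y \<in> carrier K. \<forall>z \<in> carrier K.
     f (x, y) \<otimes>\<^bsub>H\<^esub> f (x \<otimes>\<^bsub>K\<^esub> y, z) = f (y, z) \<otimes>\<^bsub>H\<^esub> f (x, y \<otimes>\<^bsub>K\<^esub> z))" (is "_ \<longleftrightarrow> ?C")
proof
  assume "group G"
  then interpret G: group G .
  show ?C
  proof (intro ballI)
    fix x y z assume "x \<in> carrier K" "y \<in> carrier K" "z \<in> carrier K"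
    then show "f (x, y) \<otimes>\<^bsub>H\<^esub> f (x \<otimes>\<^bsub>K\<^esub> y, z) = f (y, z) \<otimes>\<^bsub>H\<^esub> f (x, y \<otimes>\<^bsub>K\<^esub> z)"
      using G.m_assoc[of "(\<one>\<^bsub>H\<^esub>, x)" "(\<one>\<^bsub>H\<^esub>, y)" "(\<one>\<^bsub>H\<^esub>, z)"] by simp
  qed
next
  assume C: ?C
  show "group G"
  proof (rule groupI; clarsimp)
    fix a b c x y z
    assume in_H: "a \<in> carrier H" "b \<in> carrier H" "c \<in> carrier H"
      and in_K: "x \<in> carrier K" "y \<in> carrier K" "z \<in> carrier K"
    have "a \<otimes>\<^bsub>H\<^esub> b \<otimes>\<^bsub>H\<^esub> f (x, y) \<otimes>\<^bsub>H\<^esub> c \<otimes>\<^bsub>H\<^esub> f (x \<otimes>\<^bsub>K\<^esub> y, z)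
        = a \<otimes>\<^bsub>H\<^esub> b \<otimes>\<^bsub>H\<^esub> c \<otimes>\<^bsub>H\<^esub> (f (x, y) \<otimes>\<^bsub>H\<^esub> f (x \<otimes>\<^bsub>K\<^esub> y, z))"
      using in_H in_K by (simp add: H.m_ac)
    also have "\<dots> = a \<otimes>\<^bsub>H\<^esub> b \<otimes>\<^bsub>H\<^esub> c \<otimes>\<^bsub>H\<^esub> (f (y, z) \<otimes>\<^bsub>H\<^esub> f (x, y \<otimes>\<^bsub>K\<^esub> z))"
      using C in_K by simp
    finally show "a \<otimes>\<^bsub>H\<^esub> b \<otimes>\<^bsub>H\<^esub> f (x, y) \<otimes>\<^bsub>H\<^esub> c \<otimes>\<^bsub>H\<^esub> f (x \<otimes>\<^bsub>K\<^esub> y, z)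
        = a \<otimes>\<^bsub>H\<^esub> (b \<otimes>\<^bsub>H\<^esub> c \<otimes>\<^bsub>H\<^esub> f (y, z)) \<otimes>\<^bsub>H\<^esub> f (x, y \<otimes>\<^bsub>K\<^esub> z)
        \<and> x \<otimes>\<^bsub>K\<^esub> y \<otimes>\<^bsub>K\<^esub> z = x \<otimes>\<^bsub>K\<^esub> (y \<otimes>\<^bsub>K\<^esub> z)"
      using in_H in_K by (simp add: H.m_ac K.m_assoc)
  next
    fix a x assume "a \<in> carrier H" "x \<in> carrier K"
    then show "\<exists>b\<in>carrier H. \<exists>y\<in>carrier K. b \<otimes>\<^bsub>H\<^esub> a \<otimes>\<^bsub>H\<^esub> f (y, x) = \<one>\<^bsub>H\<^esub> \<and> y \<otimes>\<^bsub>K\<^esub> x = \<one>\<^bsub>K\<^esub>"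
      using twisted_left_inv[of a x] by (intro bexI[of _ "inv\<^bsub>H\<^esub> a \<otimes>\<^bsub>H\<^esub> inv\<^bsub>H\<^esub> (f (inv\<^bsub>K\<^esub> x, x))"] bexI[of _ "inv\<^bsub>K\<^esub> x"]) simp_all
  qed
qed

lemma cocycle_if_mult_lie_algebra:
  assumes "mult_lie_algebra G"
  shows "is_cocycle H K (f, h, \<Gamma>)"
proof -
  interpret G: mult_lie_algebra G by fact
  note conj = conj_twisted[OF G.is_group]
  show ?thesis
    unfolding is_cocycle_def case_prod_conv
  proof (intro conjI ballI)
    fix x y z assume in_K [simp]: "x \<in> carrier K" "y \<in> carrier K" "z \<in> carrier K"
    let ?t = "\<lambda>x. (\<one>\<^bsub>H\<^esub>, x)"
    have t [simp]: "?t x \<in> carrier G" "?t y \<in> carrier G" "?t z \<in> carrier G" by simp_all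
    show "f (x, y) \<otimes>\<^bsub>H\<^esub> f (x \<otimes>\<^bsub>K\<^esub> y, z) = f (y, z) \<otimes>\<^bsub>H\<^esub> f (x, y \<otimes>\<^bsub>K\<^esub> z)"
      using iffD1[OF group_twisted_iff G.is_group] by simp
    \<comment> \<open>The last two are the statement that bracketing with the unit of
      \<open>G\<close> is trivial, itself a consequence of the distributive laws.\<close>
    show "h (x, x) = \<one>\<^bsub>H\<^esub>" "h (x, \<one>\<^bsub>K\<^esub>) = \<one>\<^bsub>H\<^esub>" "h (\<one>\<^bsub>K\<^esub>, x) = \<one>\<^bsub>H\<^esub>"
      using G.lie_self[of "?t x"] G.lie_one_right[of "?t x"] G.lie_one_left[of "?t x"] by simp_all
    show "h (x, y) \<otimes>\<^bsub>H\<^esub> h (x, z) \<otimes>\<^bsub>H\<^esub>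
         f (y, x \<star>\<^bsub>K\<^esub> z) \<otimes>\<^bsub>H\<^esub> inv\<^bsub>H\<^esub> (f (inv\<^bsub>K\<^esub> y, y)) \<otimes>\<^bsub>H\<^esub> f (y \<otimes>\<^bsub>K\<^esub> (x \<star>\<^bsub>K\<^esub> z), inv\<^bsub>K\<^esub> y) \<otimes>\<^bsub>H\<^esub>
         f (x \<star>\<^bsub>K\<^esub> y, conj_by K y (x \<star>\<^bsub>K\<^esub> z))
         = \<Gamma> x (f (y, z)) \<otimes>\<^bsub>H\<^esub> h (x, y \<otimes>\<^bsub>K\<^esub> z)"
      using G.lie_mult_right[OF t(1) t(2) t(3)]
      by (simp add: conj conj_defect_def H.m_ac)
    show "h (x, z) \<otimes>\<^bsub>H\<^esub> h (y, z) \<otimes>\<^bsub>H\<^esub>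
         f (x, y \<star>\<^bsub>K\<^esub> z) \<otimes>\<^bsub>H\<^esub> inv\<^bsub>H\<^esub> (f (inv\<^bsub>K\<^esub> x, x)) \<otimes>\<^bsub>H\<^esub> f (x \<otimes>\<^bsub>K\<^esub> (y \<star>\<^bsub>K\<^esub> z), inv\<^bsub>K\<^esub> x) \<otimes>\<^bsub>H\<^esub>
         f (conj_by K x (y \<star>\<^bsub>K\<^esub> z), x \<star>\<^bsub>K\<^esub> z)
         = \<Gamma> z (inv\<^bsub>H\<^esub> (f (x, y))) \<otimes>\<^bsub>H\<^esub> h (x \<otimes>\<^bsub>K\<^esub> y, z)"
      using G.lie_mult_left[OF t(1) t(2) t(3)]
      by (simp add: conj conj_defect_def H.m_ac)
    show "\<Gamma> x (f (z, y) \<otimes>\<^bsub>H\<^esub> inv\<^bsub>H\<^esub> (f (inv\<^bsub>K\<^esub> z, z)) \<otimes>\<^bsub>H\<^esub> f (z \<otimes>\<^bsub>K\<^esub> y, inv\<^bsub>K\<^esub> z)) \<otimes>\<^bsub>H\<^esub>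
         \<Gamma> y (inv\<^bsub>H\<^esub> (f (z, x)) \<otimes>\<^bsub>H\<^esub> f (inv\<^bsub>K\<^esub> z, z) \<otimes>\<^bsub>H\<^esub> inv\<^bsub>H\<^esub> (f (z \<otimes>\<^bsub>K\<^esub> x, inv\<^bsub>K\<^esub> z))) \<otimes>\<^bsub>H\<^esub>
         h (conj_by K z x, conj_by K z y)
         = h (x, y) \<otimes>\<^bsub>H\<^esub> f (z, x \<star>\<^bsub>K\<^esub> y) \<otimes>\<^bsub>H\<^esub> inv\<^bsub>H\<^esub> (f (inv\<^bsub>K\<^esub> z, z)) \<otimes>\<^bsub>H\<^esub> f (z \<otimes>\<^bsub>K\<^esub> (x \<star>\<^bsub>K\<^esub> y), inv\<^bsub>K\<^esub> z)"
      using G.lie_conj[OF t(1) t(2) t(3)]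
      by (simp add: conj conj_defect_def H.m_ac H.inv_mult)
    show "\<Gamma> (x \<star>\<^bsub>K\<^esub> y) (f (y, z) \<otimes>\<^bsub>H\<^esub> inv\<^bsub>H\<^esub> (f (inv\<^bsub>K\<^esub> y, y)) \<otimes>\<^bsub>H\<^esub> f (y \<otimes>\<^bsub>K\<^esub> z, inv\<^bsub>K\<^esub> y)) \<otimes>\<^bsub>H\<^esub>
         \<Gamma> (y \<star>\<^bsub>K\<^esub> z) (f (z, x) \<otimes>\<^bsub>H\<^esub> inv\<^bsub>H\<^esub> (f (inv\<^bsub>K\<^esub> z, z)) \<otimes>\<^bsub>H\<^esub> f (z \<otimes>\<^bsub>K\<^esub> x, inv\<^bsub>K\<^esub> z)) \<otimes>\<^bsub>H\<^esub>
         \<Gamma> (z \<star>\<^bsub>K\<^esub> x) (f (x, y) \<otimes>\<^bsub>H\<^esub> inv\<^bsub>H\<^esub> (f (inv\<^bsub>K\<^esub> x, x)) \<otimes>\<^bsub>H\<^esub> f (x \<otimes>\<^bsub>K\<^esub> y, inv\<^bsub>K\<^esub> x)) \<otimes>\<^bsub>H\<^esub>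
         \<Gamma> z (inv\<^bsub>H\<^esub> (h (x, y))) \<otimes>\<^bsub>H\<^esub> \<Gamma> x (inv\<^bsub>H\<^esub> (h (y, z))) \<otimes>\<^bsub>H\<^esub> \<Gamma> y (inv\<^bsub>H\<^esub> (h (z, x))) \<otimes>\<^bsub>H\<^esub>
         h (x \<star>\<^bsub>K\<^esub> y, conj_by K y z) \<otimes>\<^bsub>H\<^esub> h (y \<star>\<^bsub>K\<^esub> z, conj_by K z x) \<otimes>\<^bsub>H\<^esub> h (z \<star>\<^bsub>K\<^esub> x, conj_by K x y) \<otimes>\<^bsub>H\<^esub>
         f ((x \<star>\<^bsub>K\<^esub> y) \<star>\<^bsub>K\<^esub> (conj_by K y z), (y \<star>\<^bsub>K\<^esub> z) \<star>\<^bsub>K\<^esub> (conj_by K z x)) \<otimes>\<^bsub>H\<^esub>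
         f (((x \<star>\<^bsub>K\<^esub> y) \<star>\<^bsub>K\<^esub> (conj_by K y z)) \<otimes>\<^bsub>K\<^esub> ((y \<star>\<^bsub>K\<^esub> z) \<star>\<^bsub>K\<^esub> (conj_by K z x)), (z \<star>\<^bsub>K\<^esub> x) \<star>\<^bsub>K\<^esub> (conj_by K x y))
         = \<one>\<^bsub>H\<^esub>"
      using G.lie_jacobi[OF t(1) t(2) t(3)]
      by (simp add: conj flip: conj_defect_def) (simp add: H.m_ac)
  qed (use f_type h_type in auto)
qed

lemma mult_lie_algebra_if_cocycle:
  assumes "is_cocycle H K (f, h, \<Gamma>)"
  shows "mult_lie_algebra G"
proof -
  \<comment> \<open>The conditions in the shape in which the laws of \<open>G\<close> will produce
    them: discrepancies folded into \<open>conj_defect\<close>, and inverses moved outside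
    \<Gamma>.\<close>
  have C: "f (x, y) \<otimes>\<^bsub>H\<^esub> f (x \<otimes>\<^bsub>K\<^esub> y, z) = f (y, z) \<otimes>\<^bsub>H\<^esub> f (x, y \<otimes>\<^bsub>K\<^esub> z)"
      "h (x, x) = \<one>\<^bsub>H\<^esub>"
      "h (x, y) \<otimes>\<^bsub>H\<^esub> h (x, z) \<otimes>\<^bsub>H\<^esub> conj_defect y (x \<star>\<^bsub>K\<^esub> z) \<otimes>\<^bsub>H\<^esub> f (x \<star>\<^bsub>K\<^esub> y, conj_by K y (x \<star>\<^bsub>K\<^esub> z))
         = \<Gamma> x (f (y, z)) \<otimes>\<^bsub>H\<^esub> h (x, y \<otimes>\<^bsub>K\<^esub> z)"
      "h (x, z) \<otimes>\<^bsub>H\<^esub> h (y, z) \<otimes>\<^bsub>H\<^esub> conj_defect x (y \<star>\<^bsub>K\<^esub> z) \<otimes>\<^bsub>H\<^esub> f (conj_by K x (y \<star>\<^bsub>K\<^esub> z), x \<star>\<^bsub>K\<^esub> z)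
         = inv\<^bsub>H\<^esub> \<Gamma> z (f (x, y)) \<otimes>\<^bsub>H\<^esub> h (x \<otimes>\<^bsub>K\<^esub> y, z)"
      "\<Gamma> x (conj_defect z y) \<otimes>\<^bsub>H\<^esub> inv\<^bsub>H\<^esub> \<Gamma> y (conj_defect z x) \<otimes>\<^bsub>H\<^esub> h (conj_by K z x, conj_by K z y)
         = h (x, y) \<otimes>\<^bsub>H\<^esub> conj_defect z (x \<star>\<^bsub>K\<^esub> y)"
      "\<Gamma> (x \<star>\<^bsub>K\<^esub> y) (conj_defect y z) \<otimes>\<^bsub>H\<^esub> \<Gamma> (y \<star>\<^bsub>K\<^esub> z) (conj_defect z x) \<otimes>\<^bsub>H\<^esub>
         \<Gamma> (z \<star>\<^bsub>K\<^esub> x) (conj_defect x y) \<otimes>\<^bsub>H\<^esub>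
         inv\<^bsub>H\<^esub> \<Gamma> z (h (x, y)) \<otimes>\<^bsub>H\<^esub> inv\<^bsub>H\<^esub> \<Gamma> x (h (y, z)) \<otimes>\<^bsub>H\<^esub> inv\<^bsub>H\<^esub> \<Gamma> y (h (z, x)) \<otimes>\<^bsub>H\<^esub>
         h (x \<star>\<^bsub>K\<^esub> y, conj_by K y z) \<otimes>\<^bsub>H\<^esub> h (y \<star>\<^bsub>K\<^esub> z, conj_by K z x) \<otimes>\<^bsub>H\<^esub> h (z \<star>\<^bsub>K\<^esub> x, conj_by K x y) \<otimes>\<^bsub>H\<^esub>
         f ((x \<star>\<^bsub>K\<^esub> y) \<star>\<^bsub>K\<^esub> (conj_by K y z), (y \<star>\<^bsub>K\<^esub> z) \<star>\<^bsub>K\<^esub> (conj_by K z x)) \<otimes>\<^bsub>H\<^esub>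
         f (((x \<star>\<^bsub>K\<^esub> y) \<star>\<^bsub>K\<^esub> (conj_by K y z)) \<otimes>\<^bsub>K\<^esub> ((y \<star>\<^bsub>K\<^esub> z) \<star>\<^bsub>K\<^esub> (conj_by K z x)), (z \<star>\<^bsub>K\<^esub> x) \<star>\<^bsub>K\<^esub> (conj_by K x y))
         = \<one>\<^bsub>H\<^esub>"
    if "x \<in> carrier K" "y \<in> carrier K" "z \<in> carrier K" for x y z
  proof -
    note [simp] = that
    note c = assms[unfolded is_cocycle_def case_prod_conv, THEN conjunct2, THEN conjunct2, rule_format, OF that]
    note c2 = c[THEN conjunct2]
    note c3 = c2[THEN conjunct2]
    note c4 = c3[THEN conjunct2]
    note c5 = c4[THEN conjunct2]
    note c6 = c5[THEN conjunct2]
    show "f (x, y) \<otimes>\<^bsub>H\<^esub> f (x \<otimes>\<^bsub>K\<^esub> y, z) = f (y, z) \<otimes>\<^bsub>H\<^esub> f (x, y \<otimes>\<^bsub>K\<^esub> z)" "h (x, x) = \<one>\<^bsub>H\<^esub>"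
      using c by blast+
    show "h (x, y) \<otimes>\<^bsub>H\<^esub> h (x, z) \<otimes>\<^bsub>H\<^esub> conj_defect y (x \<star>\<^bsub>K\<^esub> z) \<otimes>\<^bsub>H\<^esub> f (x \<star>\<^bsub>K\<^esub> y, conj_by K y (x \<star>\<^bsub>K\<^esub> z))
         = \<Gamma> x (f (y, z)) \<otimes>\<^bsub>H\<^esub> h (x, y \<otimes>\<^bsub>K\<^esub> z)"
      using c3[THEN conjunct1] by (simp add: conj_defect_def H.m_assoc H.inv_mult)
    show "h (x, z) \<otimes>\<^bsub>H\<^esub> h (y, z) \<otimes>\<^bsub>H\<^esub> conj_defect x (y \<star>\<^bsub>K\<^esub> z) \<otimes>\<^bsub>H\<^esub> f (conj_by K x (y \<star>\<^bsub>K\<^esub> z), x \<star>\<^bsub>K\<^esub> z)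
         = inv\<^bsub>H\<^esub> \<Gamma> z (f (x, y)) \<otimes>\<^bsub>H\<^esub> h (x \<otimes>\<^bsub>K\<^esub> y, z)"
      using c4[THEN conjunct1] by (simp add: conj_defect_def H.m_assoc H.inv_mult)
    show "\<Gamma> x (conj_defect z y) \<otimes>\<^bsub>H\<^esub> inv\<^bsub>H\<^esub> \<Gamma> y (conj_defect z x) \<otimes>\<^bsub>H\<^esub> h (conj_by K z x, conj_by K z y)
         = h (x, y) \<otimes>\<^bsub>H\<^esub> conj_defect z (x \<star>\<^bsub>K\<^esub> y)"
      using c5[THEN conjunct1] by (simp add: conj_defect_def H.m_assoc H.inv_mult)
    show "\<Gamma> (x \<star>\<^bsub>K\<^esub> y) (conj_defect y z) \<otimes>\<^bsub>H\<^esub> \<Gamma> (y \<star>\<^bsub>K\<^esub> z) (conj_defect z x) \<otimes>\<^bsub>H\<^esub>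
         \<Gamma> (z \<star>\<^bsub>K\<^esub> x) (conj_defect x y) \<otimes>\<^bsub>H\<^esub>
         inv\<^bsub>H\<^esub> \<Gamma> z (h (x, y)) \<otimes>\<^bsub>H\<^esub> inv\<^bsub>H\<^esub> \<Gamma> x (h (y, z)) \<otimes>\<^bsub>H\<^esub> inv\<^bsub>H\<^esub> \<Gamma> y (h (z, x)) \<otimes>\<^bsub>H\<^esub>
         h (x \<star>\<^bsub>K\<^esub> y, conj_by K y z) \<otimes>\<^bsub>H\<^esub> h (y \<star>\<^bsub>K\<^esub> z, conj_by K z x) \<otimes>\<^bsub>H\<^esub> h (z \<star>\<^bsub>K\<^esub> x, conj_by K x y) \<otimes>\<^bsub>H\<^esub>
         f ((x \<star>\<^bsub>K\<^esub> y) \<star>\<^bsub>K\<^esub> (conj_by K y z), (y \<star>\<^bsub>K\<^esub> z) \<star>\<^bsub>K\<^esub> (conj_by K z x)) \<otimes>\<^bsub>H\<^esub>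
         f (((x \<star>\<^bsub>K\<^esub> y) \<star>\<^bsub>K\<^esub> (conj_by K y z)) \<otimes>\<^bsub>K\<^esub> ((y \<star>\<^bsub>K\<^esub> z) \<star>\<^bsub>K\<^esub> (conj_by K z x)), (z \<star>\<^bsub>K\<^esub> x) \<star>\<^bsub>K\<^esub> (conj_by K x y))
         = \<one>\<^bsub>H\<^esub>"
      using c6 by (simp add: conj_defect_def H.m_assoc H.inv_mult)
  qed
  have group: "group G"
    unfolding group_twisted_iff using C(1) by blast
  interpret G: group G by (rule group)
  note conj = conj_twisted[OF group]
  show ?thesis
  \<comment> \<open>The K-components of the laws are the laws of K, so only identities in H are
    left.\<close>
  proof (unfold_locales; clarsimp simp: conj K.lie_self K.lie_mult_right K.lie_mult_left K.lie_jacobi K.lie_conj)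
    fix a x assume "a \<in> carrier H" "x \<in> carrier K"
    then show "h (x, x) = \<one>\<^bsub>H\<^esub>"
      using C(2) by simp
  next
    fix a x b y c z
    assume [simp]: "a \<in> carrier H" "b \<in> carrier H" "c \<in> carrier H"
      "x \<in> carrier K" "y \<in> carrier K" "z \<in> carrier K"
    \<comment> \<open>Separate the factors containing \<open>a\<close>, \<open>b\<close>,
      \<open>c\<close> from those depending on \<open>x\<close>, \<open>y\<close>, \<open>z\<close>
      alone: the latter form one side of the third condition and can be exchanged for the other. The
      next two laws are treated in the same way.\<close>
    have "\<Gamma> x b \<otimes>\<^bsub>H\<^esub> \<Gamma> x c \<otimes>\<^bsub>H\<^esub> \<Gamma> x (f (y, z)) \<otimes>\<^bsub>H\<^esub> inv\<^bsub>H\<^esub> (\<Gamma> y a \<otimes>\<^bsub>H\<^esub> \<Gamma> z a) \<otimes>\<^bsub>H\<^esub> h (x, y \<otimes>\<^bsub>K\<^esub> z)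
        = \<Gamma> x b \<otimes>\<^bsub>H\<^esub> \<Gamma> x c \<otimes>\<^bsub>H\<^esub> inv\<^bsub>H\<^esub> (\<Gamma> y a \<otimes>\<^bsub>H\<^esub> \<Gamma> z a) \<otimes>\<^bsub>H\<^esub> (\<Gamma> x (f (y, z)) \<otimes>\<^bsub>H\<^esub> h (x, y \<otimes>\<^bsub>K\<^esub> z))"
      by (simp add: H.m_ac del: \<Gamma>_mult_arg)
    then show "\<Gamma> x b \<otimes>\<^bsub>H\<^esub> \<Gamma> x c \<otimes>\<^bsub>H\<^esub> \<Gamma> x (f (y, z)) \<otimes>\<^bsub>H\<^esub> inv\<^bsub>H\<^esub> (\<Gamma> y a \<otimes>\<^bsub>H\<^esub> \<Gamma> z a) \<otimes>\<^bsub>H\<^esub> h (x, y \<otimes>\<^bsub>K\<^esub> z)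
        = \<Gamma> x b \<otimes>\<^bsub>H\<^esub> inv\<^bsub>H\<^esub> \<Gamma> y a \<otimes>\<^bsub>H\<^esub> h (x, y) \<otimes>\<^bsub>H\<^esub>
          (\<Gamma> x c \<otimes>\<^bsub>H\<^esub> inv\<^bsub>H\<^esub> \<Gamma> z a \<otimes>\<^bsub>H\<^esub> h (x, z) \<otimes>\<^bsub>H\<^esub> conj_defect y (x \<star>\<^bsub>K\<^esub> z)) \<otimes>\<^bsub>H\<^esub>
          f (x \<star>\<^bsub>K\<^esub> y, conj_by K y x \<star>\<^bsub>K\<^esub> conj_by K y z)"
      by (simp add: K.lie_conj H.inv_mult H.m_ac flip: C(3))
    have four: "\<Gamma> x c \<otimes>\<^bsub>H\<^esub> \<Gamma> y c \<otimes>\<^bsub>H\<^esub> inv\<^bsub>H\<^esub> (\<Gamma> z a \<otimes>\<^bsub>H\<^esub> \<Gamma> z b \<otimes>\<^bsub>H\<^esub> \<Gamma> z (f (x, y))) \<otimes>\<^bsub>H\<^esub> h (x \<otimes>\<^bsub>K\<^esub> y, z)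
        = \<Gamma> x c \<otimes>\<^bsub>H\<^esub> \<Gamma> y c \<otimes>\<^bsub>H\<^esub> inv\<^bsub>H\<^esub> (\<Gamma> z a \<otimes>\<^bsub>H\<^esub> \<Gamma> z b) \<otimes>\<^bsub>H\<^esub> (inv\<^bsub>H\<^esub> \<Gamma> z (f (x, y)) \<otimes>\<^bsub>H\<^esub> h (x \<otimes>\<^bsub>K\<^esub> y, z))"
      by (simp add: H.inv_mult H.m_ac)
    show "\<Gamma> x c \<otimes>\<^bsub>H\<^esub> \<Gamma> y c \<otimes>\<^bsub>H\<^esub> inv\<^bsub>H\<^esub> (\<Gamma> z a \<otimes>\<^bsub>H\<^esub> \<Gamma> z b \<otimes>\<^bsub>H\<^esub> \<Gamma> z (f (x, y))) \<otimes>\<^bsub>H\<^esub> h (x \<otimes>\<^bsub>K\<^esub> y, z)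
        = \<Gamma> y c \<otimes>\<^bsub>H\<^esub> inv\<^bsub>H\<^esub> \<Gamma> z b \<otimes>\<^bsub>H\<^esub> h (y, z) \<otimes>\<^bsub>H\<^esub> conj_defect x (y \<star>\<^bsub>K\<^esub> z) \<otimes>\<^bsub>H\<^esub>
          (\<Gamma> x c \<otimes>\<^bsub>H\<^esub> inv\<^bsub>H\<^esub> \<Gamma> z a \<otimes>\<^bsub>H\<^esub> h (x, z)) \<otimes>\<^bsub>H\<^esub>
          f (conj_by K x y \<star>\<^bsub>K\<^esub> conj_by K x z, x \<star>\<^bsub>K\<^esub> z)"
      unfolding four by (subst C(4)[symmetric]) (simp_all add: K.lie_conj H.inv_mult H.m_ac)
    have "\<Gamma> x b \<otimes>\<^bsub>H\<^esub> inv\<^bsub>H\<^esub> \<Gamma> y a \<otimes>\<^bsub>H\<^esub> h (x, y) \<otimes>\<^bsub>H\<^esub> conj_defect z (x \<star>\<^bsub>K\<^esub> y)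
        = \<Gamma> x b \<otimes>\<^bsub>H\<^esub> inv\<^bsub>H\<^esub> \<Gamma> y a \<otimes>\<^bsub>H\<^esub> (h (x, y) \<otimes>\<^bsub>H\<^esub> conj_defect z (x \<star>\<^bsub>K\<^esub> y))"
      by (simp add: H.m_assoc)
    then show "\<Gamma> x b \<otimes>\<^bsub>H\<^esub> inv\<^bsub>H\<^esub> \<Gamma> y a \<otimes>\<^bsub>H\<^esub> h (x, y) \<otimes>\<^bsub>H\<^esub> conj_defect z (x \<star>\<^bsub>K\<^esub> y)
        = \<Gamma> x b \<otimes>\<^bsub>H\<^esub> \<Gamma> x (conj_defect z y) \<otimes>\<^bsub>H\<^esub> inv\<^bsub>H\<^esub> (\<Gamma> y a \<otimes>\<^bsub>H\<^esub> \<Gamma> y (conj_defect z x)) \<otimes>\<^bsub>H\<^esub>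
          h (conj_by K z x, conj_by K z y)"
      by (simp add: H.inv_mult H.m_ac flip: C(5))
    \<comment> \<open>The total contribution of one H-component to the Jacobi product:
      \<open>c\<close> meets \<Gamma> of a bracket in one of the three factors and an iterated
      action in each of the other two. It is trivial by the definition of the bracket in End(H);
      \<open>a\<close> and \<open>b\<close> follow by cyclic symmetry.\<close>
    let ?act = "\<lambda>x y c. \<Gamma> (x \<star>\<^bsub>K\<^esub> y) c \<otimes>\<^bsub>H\<^esub> \<Gamma> y (\<Gamma> x c) \<otimes>\<^bsub>H\<^esub> inv\<^bsub>H\<^esub> \<Gamma> x (\<Gamma> y c)"
    have act: "?act x y c = \<one>\<^bsub>H\<^esub>" if "x \<in> carrier K" "y \<in> carrier K" "c \<in> carrier H" for x y c
      using that by (simp add: \<Gamma>_lie H.m_ac H.r_inv_ex)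
    show "\<Gamma> (x \<star>\<^bsub>K\<^esub> y) c \<otimes>\<^bsub>H\<^esub> \<Gamma> (x \<star>\<^bsub>K\<^esub> y) (conj_defect y z) \<otimes>\<^bsub>H\<^esub>
           inv\<^bsub>H\<^esub> (\<Gamma> z (\<Gamma> x b) \<otimes>\<^bsub>H\<^esub> inv\<^bsub>H\<^esub> \<Gamma> z (\<Gamma> y a) \<otimes>\<^bsub>H\<^esub> \<Gamma> z (h (x, y))) \<otimes>\<^bsub>H\<^esub>
           h (x \<star>\<^bsub>K\<^esub> y, conj_by K y z) \<otimes>\<^bsub>H\<^esub>
           (\<Gamma> (y \<star>\<^bsub>K\<^esub> z) a \<otimes>\<^bsub>H\<^esub> \<Gamma> (y \<star>\<^bsub>K\<^esub> z) (conj_defect z x) \<otimes>\<^bsub>H\<^esub>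
            inv\<^bsub>H\<^esub> (\<Gamma> x (\<Gamma> y c) \<otimes>\<^bsub>H\<^esub> inv\<^bsub>H\<^esub> \<Gamma> x (\<Gamma> z b) \<otimes>\<^bsub>H\<^esub> \<Gamma> x (h (y, z))) \<otimes>\<^bsub>H\<^esub>
            h (y \<star>\<^bsub>K\<^esub> z, conj_by K z x)) \<otimes>\<^bsub>H\<^esub>
           f (x \<star>\<^bsub>K\<^esub> y \<star>\<^bsub>K\<^esub> conj_by K y z, y \<star>\<^bsub>K\<^esub> z \<star>\<^bsub>K\<^esub> conj_by K z x) \<otimes>\<^bsub>H\<^esub>
           (\<Gamma> (z \<star>\<^bsub>K\<^esub> x) b \<otimes>\<^bsub>H\<^esub> \<Gamma> (z \<star>\<^bsub>K\<^esub> x) (conj_defect x y) \<otimes>\<^bsub>H\<^esub>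
            inv\<^bsub>H\<^esub> (\<Gamma> y (\<Gamma> z a) \<otimes>\<^bsub>H\<^esub> inv\<^bsub>H\<^esub> \<Gamma> y (\<Gamma> x c) \<otimes>\<^bsub>H\<^esub> \<Gamma> y (h (z, x))) \<otimes>\<^bsub>H\<^esub>
            h (z \<star>\<^bsub>K\<^esub> x, conj_by K x y)) \<otimes>\<^bsub>H\<^esub>
           f (x \<star>\<^bsub>K\<^esub> y \<star>\<^bsub>K\<^esub> conj_by K y z \<otimes>\<^bsub>K\<^esub> (y \<star>\<^bsub>K\<^esub> z \<star>\<^bsub>K\<^esub> conj_by K z x),
              z \<star>\<^bsub>K\<^esub> x \<star>\<^bsub>K\<^esub> conj_by K x y) = \<one>\<^bsub>H\<^esub>" (is "?L = _")
    proof -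
      have "?L = ?act x y c \<otimes>\<^bsub>H\<^esub> ?act y z a \<otimes>\<^bsub>H\<^esub> ?act z x b \<otimes>\<^bsub>H\<^esub> (\<Gamma> (x \<star>\<^bsub>K\<^esub> y) (conj_defect y z) \<otimes>\<^bsub>H\<^esub> \<Gamma> (y \<star>\<^bsub>K\<^esub> z) (conj_defect z x) \<otimes>\<^bsub>H\<^esub>
         \<Gamma> (z \<star>\<^bsub>K\<^esub> x) (conj_defect x y) \<otimes>\<^bsub>H\<^esub>
         inv\<^bsub>H\<^esub> \<Gamma> z (h (x, y)) \<otimes>\<^bsub>H\<^esub> inv\<^bsub>H\<^esub> \<Gamma> x (h (y, z)) \<otimes>\<^bsub>H\<^esub> inv\<^bsub>H\<^esub> \<Gamma> y (h (z, x)) \<otimes>\<^bsub>H\<^esub>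
         h (x \<star>\<^bsub>K\<^esub> y, conj_by K y z) \<otimes>\<^bsub>H\<^esub> h (y \<star>\<^bsub>K\<^esub> z, conj_by K z x) \<otimes>\<^bsub>H\<^esub> h (z \<star>\<^bsub>K\<^esub> x, conj_by K x y) \<otimes>\<^bsub>H\<^esub>
         f ((x \<star>\<^bsub>K\<^esub> y) \<star>\<^bsub>K\<^esub> (conj_by K y z), (y \<star>\<^bsub>K\<^esub> z) \<star>\<^bsub>K\<^esub> (conj_by K z x)) \<otimes>\<^bsub>H\<^esub>
         f (((x \<star>\<^bsub>K\<^esub> y) \<star>\<^bsub>K\<^esub> (conj_by K y z)) \<otimes>\<^bsub>K\<^esub> ((y \<star>\<^bsub>K\<^esub> z) \<star>\<^bsub>K\<^esub> (conj_by K z x)), (z \<star>\<^bsub>K\<^esub> x) \<star>\<^bsub>K\<^esub> (conj_by K x y)))"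
        by (simp add: H.inv_mult H.m_ac)
      also have "\<dots> = \<one>\<^bsub>H\<^esub>"
        by (subst C(6)) (simp_all add: act)
      finally show ?thesis .
    qed
  qed
qed

end

section \<open>Transport of structure, and equivalence of extensions\<close>

text \<open>Each law holds after applying \<open>e\<close>, and \<open>e\<close> is injective;
  surjectivity is used for inverses. Applied to the identification of H x K with a middle term, it
  makes the twisted structure of a section a multiplicative Lie algebra before anything is known
  about its cochains.\<close>

lemma mult_lie_algebra_transport:
  assumes M: "mult_lie_algebra M"
    and bij: "bij_betw e (carrier G) (carrier M)"
    and one: "\<one>\<^bsub>G\<^esub> \<in> carrier G" "e \<one>\<^bsub>G\<^esub> = \<one>\<^bsub>M\<^esub>"
    and mult: "\<And>x y. \<lbrakk>x \<in> carrier G; y \<in> carrier G\<rbrakk> \<Longrightarrow> x \<otimes>\<^bsub>G\<^esub> y \<in> carrier G"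
      "\<And>x y. \<lbrakk>x \<in> carrier G; y \<in> carrier G\<rbrakk> \<Longrightarrow> e (x \<otimes>\<^bsub>G\<^esub> y) = e x \<otimes>\<^bsub>M\<^esub> e y"
    and lie: "\<And>x y. \<lbrakk>x \<in> carrier G; y \<in> carrier G\<rbrakk> \<Longrightarrow> x \<star>\<^bsub>G\<^esub> y \<in> carrier G"
      "\<And>x y. \<lbrakk>x \<in> carrier G; y \<in> carrier G\<rbrakk> \<Longrightarrow> e (x \<star>\<^bsub>G\<^esub> y) = e x \<star>\<^bsub>M\<^esub> e y"
  shows "mult_lie_algebra G"
proof -
  interpret M: mult_lie_algebra M by fact
  have e [simp]: "e x \<in> carrier M" if "x \<in> carrier G" for x
    using bij that by (auto simp: bij_betw_def)
  have inj: "x = y" if "e x = e y" "x \<in> carrier G" "y \<in> carrier G" for x y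
    using bij that by (auto simp: bij_betw_def inj_on_def)
  note [simp] = one mult lie
  have "group G"
  proof (rule groupI)
    fix x assume x: "x \<in> carrier G"
    obtain y where "y \<in> carrier G" "e y = inv\<^bsub>M\<^esub> e x"
      using bij x by (metis M.inv_closed bij_betw_iff_bijections e)
    then show "\<exists>y\<in>carrier G. y \<otimes>\<^bsub>G\<^esub> x = \<one>\<^bsub>G\<^esub>"
      using x by (intro bexI[of _ y]) (auto intro: inj)
  qed (auto intro: inj simp: M.m_assoc)
  then interpret G: group G .
  interpret e: group_hom G M e
    by unfold_locales (simp add: hom_def)
  have conj [simp]: "conj_by G x y \<in> carrier G" "e (conj_by G x y) = conj_by M (e x) (e y)"
    if "x \<in> carrier G" "y \<in> carrier G" for x y
    using that by (simp_all add: conj_by_def)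
  show ?thesis
    by unfold_locales
      (auto intro!: inj simp: M.lie_self M.lie_mult_right M.lie_mult_left M.lie_jacobi M.lie_conj)
qed

lemma equiv_extension_refl: "equiv_extension H E E"
  unfolding equiv_extension_def
  by (rule bexI[of _ "\<lambda>x. x"]) (auto simp: mlie_iso_def mlie_hom_def hom_def bij_betw_def)

text \<open>An equivalence is only a map with given values on carriers. That \<open>E1\<close> is an
  extension keeps its products, brackets and embedded elements in the carrier, where the inverse map
  can be evaluated.\<close>

lemma equiv_extension_sym:
  assumes E: "is_extension H K E1" and eq: "equiv_extension H E1 E2"
  shows "equiv_extension H E2 E1"
proof -
  interpret M: mult_lie_algebra "middle E1"
    using E by (simp add: is_extension_def)
  have incl: "\<And>a. a \<in> carrier H \<Longrightarrow> incl E1 a \<in> carrier (middle E1)"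
    using E by (auto simp: is_extension_def mlie_hom_def hom_def)
  obtain \<phi> where \<phi>: "\<phi> \<in> mlie_iso (middle E1) (middle E2)"
      "\<And>a. a \<in> carrier H \<Longrightarrow> \<phi> (incl E1 a) = incl E2 a"
      "\<And>g. g \<in> carrier (middle E1) \<Longrightarrow> proj E2 (\<phi> g) = proj E1 g"
    using eq by (auto simp: equiv_extension_def)
  let ?\<psi> = "inv_into (carrier (middle E1)) \<phi>"
  have bij: "bij_betw \<phi> (carrier (middle E1)) (carrier (middle E2))"
    and mult: "\<And>x y. \<lbrakk>x \<in> carrier (middle E1); y \<in> carrier (middle E1)\<rbrakk>
      \<Longrightarrow> \<phi> (x \<otimes>\<^bsub>middle E1\<^esub> y) = \<phi> x \<otimes>\<^bsub>middle E2\<^esub> \<phi> y"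
    and lie: "\<And>x y. \<lbrakk>x \<in> carrier (middle E1); y \<in> carrier (middle E1)\<rbrakk>
      \<Longrightarrow> \<phi> (x \<star>\<^bsub>middle E1\<^esub> y) = \<phi> x \<star>\<^bsub>middle E2\<^esub> \<phi> y"
    using \<phi>(1) by (auto simp: mlie_iso_def mlie_hom_def hom_def)
  have \<psi>: "?\<psi> u \<in> carrier (middle E1)" "\<phi> (?\<psi> u) = u" if "u \<in> carrier (middle E2)" for u
    using bij that by (auto simp: bij_betw_def inv_into_into f_inv_into_f)
  have left: "?\<psi> (\<phi> g) = g" if "g \<in> carrier (middle E1)" for g
    using bij that by (simp add: bij_betw_def)
  have "?\<psi> (u \<otimes>\<^bsub>middle E2\<^esub> v) = ?\<psi> u \<otimes>\<^bsub>middle E1\<^esub> ?\<psi> v"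
    "?\<psi> (u \<star>\<^bsub>middle E2\<^esub> v) = ?\<psi> u \<star>\<^bsub>middle E1\<^esub> ?\<psi> v"
    if "u \<in> carrier (middle E2)" "v \<in> carrier (middle E2)" for u v
    using left[of "?\<psi> u \<otimes>\<^bsub>middle E1\<^esub> ?\<psi> v"] left[of "?\<psi> u \<star>\<^bsub>middle E1\<^esub> ?\<psi> v"] \<psi> that
    by (simp_all add: mult lie)
  then have "?\<psi> \<in> mlie_iso (middle E2) (middle E1)"
    using \<psi>(1) bij by (auto simp: mlie_iso_def mlie_hom_def hom_def bij_betw_inv_into)
  then show ?thesis
    unfolding equiv_extension_def
    using \<phi>(2,3) left incl \<psi> by (intro bexI[of _ ?\<psi>]) (auto, metis left incl, metis \<psi>)
qed

lemma equiv_extension_trans: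
  assumes "equiv_extension H E1 E2" "equiv_extension H E2 E3"
  shows "equiv_extension H E1 E3"
proof -
  obtain \<phi> \<psi> where \<phi>: "\<phi> \<in> mlie_iso (middle E1) (middle E2)"
      "\<forall>a \<in> carrier H. \<phi> (incl E1 a) = incl E2 a"
      "\<forall>g \<in> carrier (middle E1). proj E2 (\<phi> g) = proj E1 g"
    and \<psi>: "\<psi> \<in> mlie_iso (middle E2) (middle E3)"
      "\<forall>a \<in> carrier H. \<psi> (incl E2 a) = incl E3 a"
      "\<forall>g \<in> carrier (middle E2). proj E3 (\<psi> g) = proj E2 g"
    using assms by (auto simp: equiv_extension_def)
  have "\<phi> g \<in> carrier (middle E2)" if "g \<in> carrier (middle E1)" for g
    using \<phi>(1) that by (auto simp: mlie_iso_def mlie_hom_def hom_def)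
  moreover have "\<psi> \<circ> \<phi> \<in> mlie_iso (middle E1) (middle E3)"
    using \<phi>(1) \<psi>(1) by (auto simp: mlie_iso_def mlie_hom_def hom_def Pi_iff intro: bij_betw_trans)
  ultimately show ?thesis
    unfolding equiv_extension_def using \<phi>(2,3) \<psi>(2,3) by (intro bexI[of _ "\<psi> \<circ> \<phi>"]) auto
qed

section \<open>Coordinates on a center extension given by a section\<close>

locale sectioned_extension = center_data H K \<Gamma>
  for H :: "('h, 'm) mlie_scheme" and K :: "('k, 'n) mlie_scheme" and \<Gamma> +
  fixes E :: "('h, 'g, 'k) mlie_extension" and t
  assumes E: "E \<in> center_extensions H K \<Gamma>" and t: "is_section K E t"
begin

abbreviation M where "M \<equiv> middle E"
abbreviation i where "i \<equiv> incl E"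
abbreviation f where "f \<equiv> section_f H K E t"
abbreviation h where "h \<equiv> section_h H K E t"

lemma center_extension: "is_center_extension H K E"
  using E by (simp add: center_extensions_def)

lemma extension: "is_extension H K E"
  using center_extension by (simp add: is_center_extension_def)

sublocale M: mult_lie_algebra M
  using extension by (simp add: is_extension_def)

sublocale i: group_hom H M i
  using extension by unfold_locales (simp add: is_extension_def mlie_hom_def)

sublocale p: group_hom M K "proj E"
  using extension by unfold_locales (simp add: is_extension_def mlie_hom_def)

lemma proj_lie [simp]:
  "\<lbrakk>u \<in> carrier M; v \<in> carrier M\<rbrakk> \<Longrightarrow> proj E (u \<star>\<^bsub>M\<^esub> v) = proj E u \<star>\<^bsub>K\<^esub> proj E v"
  using extension by (simp add: is_extension_def mlie_hom_def)

lemma incl_lie [simp]: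
  "\<lbrakk>a \<in> carrier H; b \<in> carrier H\<rbrakk> \<Longrightarrow> i a \<star>\<^bsub>M\<^esub> i b = \<one>\<^bsub>M\<^esub>"
  using extension trivial i.hom_one
  by (simp add: is_extension_def mlie_hom_def trivial_mlie_def del: i.hom_one) metis

lemma incl_inj: "\<lbrakk>i a = i b; a \<in> carrier H; b \<in> carrier H\<rbrakk> \<Longrightarrow> a = b"
  using extension by (auto simp: is_extension_def inj_on_def)

lemma proj_incl [simp]: "a \<in> carrier H \<Longrightarrow> proj E (i a) = \<one>\<^bsub>K\<^esub>"
  using extension by (auto simp: is_extension_def kernel_def)

lemma incl_central:
  "\<lbrakk>a \<in> carrier H; u \<in> carrier M\<rbrakk> \<Longrightarrow> u \<otimes>\<^bsub>M\<^esub> i a = i a \<otimes>\<^bsub>M\<^esub> u"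
  using center_extension by (simp add: is_center_extension_def)

lemma conj_incl [simp]:
  "\<lbrakk>a \<in> carrier H; u \<in> carrier M\<rbrakk> \<Longrightarrow> conj_by M (i a) u = u"
  by (rule M.conj_by_commuting) (simp_all add: incl_central)

lemma to_kernel_incl [simp]: "a \<in> carrier H \<Longrightarrow> to_kernel H E (i a) = a"
  using extension by (simp add: to_kernel_def is_extension_def)

lemma incl_to_kernel:
  assumes "u \<in> carrier M" "proj E u = \<one>\<^bsub>K\<^esub>"
  shows "i (to_kernel H E u) = u" "to_kernel H E u \<in> carrier H"
proof -
  have "u \<in> i ` carrier H"
    using extension assms by (auto simp: is_extension_def kernel_def)
  then show "i (to_kernel H E u) = u" "to_kernel H E u \<in> carrier H"
    by (auto simp: to_kernel_def f_inv_into_f inv_into_into)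
qed

lemma section_closed [simp]: "x \<in> carrier K \<Longrightarrow> t x \<in> carrier M"
  using t by (auto simp: is_section_def)

lemma proj_section [simp]: "x \<in> carrier K \<Longrightarrow> proj E (t x) = x"
  using t by (auto simp: is_section_def)

lemma section_one [simp]: "t \<one>\<^bsub>K\<^esub> = \<one>\<^bsub>M\<^esub>"
  using t by (auto simp: is_section_def)

text \<open>\<open>Gamma_ext\<close> is defined with a chosen section; independence of the choice
  carries it over to \<open>t\<close>. Antisymmetry then gives the bracket in the opposite
  order.\<close>

lemma section_lie_incl [simp]:
  assumes "x \<in> carrier K" "a \<in> carrier H"
  shows "t x \<star>\<^bsub>M\<^esub> i a = i (\<Gamma> x a)" "i a \<star>\<^bsub>M\<^esub> t x = i (inv\<^bsub>H\<^esub> (\<Gamma> x a))"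
proof -
  have "Gamma_ext H K E x = section_action H E t x"
    using Gamma_ext_eq[OF center_extension K.is_group H.is_group trivial t] assms by simp
  then have "\<Gamma> x a = section_action H E t x a"
    using E assms by (simp add: center_extensions_def)
  then have "\<Gamma> x a = to_kernel H E (t x \<star>\<^bsub>M\<^esub> i a)"
    using assms by (simp add: section_action_def)
  then show *: "t x \<star>\<^bsub>M\<^esub> i a = i (\<Gamma> x a)"
    using assms by (simp add: incl_to_kernel)
  show "i a \<star>\<^bsub>M\<^esub> t x = i (inv\<^bsub>H\<^esub> (\<Gamma> x a))"
    using M.lie_antisym[of "t x" "i a"] assms by (simp add: *)
qed

text \<open>Replaces the inverse of the embedding in \<open>section_f\<close> by the defining
  equation of the cochain. The cochains of shifted, twisted and transported sections are all
  identified through this criterion and its analogue for \<open>h\<close>.\<close>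

lemma section_f_unique:
  assumes "c \<in> carrier H" "x \<in> carrier K" "y \<in> carrier K"
    and "t x \<otimes>\<^bsub>M\<^esub> t y = i c \<otimes>\<^bsub>M\<^esub> t (x \<otimes>\<^bsub>K\<^esub> y)"
  shows "f (x, y) = c"
  using assms by (simp add: section_f_def M.m_assoc)

lemma section_h_unique:
  assumes "c \<in> carrier H" "x \<in> carrier K" "y \<in> carrier K"
    and "t x \<star>\<^bsub>M\<^esub> t y = i c \<otimes>\<^bsub>M\<^esub> t (x \<star>\<^bsub>K\<^esub> y)"
  shows "h (x, y) = c"
  using assms by (simp add: section_h_def M.m_assoc)

lemma section_f_type: "f \<in> carrier K \<times> carrier K \<rightarrow>\<^sub>E carrier H"
  by (auto simp: section_f_def intro!: incl_to_kernel)

lemma section_h_type: "h \<in> carrier K \<times> carrier K \<rightarrow>\<^sub>E carrier H"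
  by (auto simp: section_h_def intro!: incl_to_kernel)

lemma section_mult:
  "\<lbrakk>x \<in> carrier K; y \<in> carrier K\<rbrakk> \<Longrightarrow> t x \<otimes>\<^bsub>M\<^esub> t y = i (f (x, y)) \<otimes>\<^bsub>M\<^esub> t (x \<otimes>\<^bsub>K\<^esub> y)"
  by (simp add: section_f_def incl_to_kernel) (simp add: M.m_assoc)

lemma section_lie:
  "\<lbrakk>x \<in> carrier K; y \<in> carrier K\<rbrakk> \<Longrightarrow> t x \<star>\<^bsub>M\<^esub> t y = i (h (x, y)) \<otimes>\<^bsub>M\<^esub> t (x \<star>\<^bsub>K\<^esub> y)"
  by (simp add: section_h_def incl_to_kernel) (simp add: M.m_assoc)

text \<open>The unit conditions hold because \<open>t\<close> sends the unit to the unit. From here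
  on \<open>G\<close> is the twisted structure on H x K that belongs to \<open>t\<close>.\<close>

sublocale normalized_cochain H K \<Gamma> f h
  by unfold_locales (rule section_f_type, rule section_h_type, auto intro!: section_f_unique)

definition combine where "combine = (\<lambda>(a, x). i a \<otimes>\<^bsub>M\<^esub> t x)"

lemma combine_eq: "combine (a, x) = i a \<otimes>\<^bsub>M\<^esub> t x"
  by (simp add: combine_def)

lemma combine_closed [simp]: "\<lbrakk>a \<in> carrier H; x \<in> carrier K\<rbrakk> \<Longrightarrow> combine (a, x) \<in> carrier M"
  by (simp add: combine_def)

lemma proj_combine [simp]: "\<lbrakk>a \<in> carrier H; x \<in> carrier K\<rbrakk> \<Longrightarrow> proj E (combine (a, x)) = x"
  by (simp add: combine_def)

lemma combine_mult:
  assumes "a \<in> carrier H" "b \<in> carrier H" "x \<in> carrier K" "y \<in> carrier K"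
  shows "combine (a, x) \<otimes>\<^bsub>M\<^esub> combine (b, y) = combine ((a, x) \<otimes>\<^bsub>G\<^esub> (b, y))"
proof -
  have "combine (a, x) \<otimes>\<^bsub>M\<^esub> combine (b, y) = i a \<otimes>\<^bsub>M\<^esub> ((t x \<otimes>\<^bsub>M\<^esub> i b) \<otimes>\<^bsub>M\<^esub> t y)"
    using assms by (simp add: combine_eq M.m_assoc)
  \<comment> \<open>Centrality of H enters here: \<open>i b\<close> moves past \<open>t x\<close>
    unchanged.\<close>
  also have "\<dots> = i a \<otimes>\<^bsub>M\<^esub> ((i b \<otimes>\<^bsub>M\<^esub> t x) \<otimes>\<^bsub>M\<^esub> t y)"
    using assms by (simp only: incl_central[of b "t x"] section_closed)
  also have "\<dots> = i a \<otimes>\<^bsub>M\<^esub> i b \<otimes>\<^bsub>M\<^esub> (t x \<otimes>\<^bsub>M\<^esub> t y)"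
    using assms by (simp add: M.m_assoc)
  finally show ?thesis
    using assms by (simp add: section_mult combine_eq M.m_assoc)
qed

text \<open>The distributive laws split the bracket into four. Their conjugations are by the central
  elements \<open>i a\<close> and \<open>i b\<close>, hence invisible, and the bracket of
  \<open>i a\<close> with \<open>i b\<close> is trivial because H is. The other three give the two
  \<Gamma>-terms and \<open>h\<close>.\<close>

lemma combine_lie:
  assumes [simp]: "a \<in> carrier H" "b \<in> carrier H" "x \<in> carrier K" "y \<in> carrier K"
  shows "combine (a, x) \<star>\<^bsub>M\<^esub> combine (b, y) = combine ((a, x) \<star>\<^bsub>G\<^esub> (b, y))"
proof -
  have right: "u \<star>\<^bsub>M\<^esub> combine (b, y) = (u \<star>\<^bsub>M\<^esub> i b) \<otimes>\<^bsub>M\<^esub> (u \<star>\<^bsub>M\<^esub> t y)" if "u \<in> carrier M" for u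
    using that by (simp add: combine_eq M.lie_mult_right)
  have "combine (a, x) \<star>\<^bsub>M\<^esub> combine (b, y)
      = (t x \<star>\<^bsub>M\<^esub> combine (b, y)) \<otimes>\<^bsub>M\<^esub> (i a \<star>\<^bsub>M\<^esub> combine (b, y))"
    by (simp add: combine_eq[of a x] M.lie_mult_left)
  also have "\<dots> = (i (\<Gamma> x b) \<otimes>\<^bsub>M\<^esub> (i (h (x, y)) \<otimes>\<^bsub>M\<^esub> t (x \<star>\<^bsub>K\<^esub> y))) \<otimes>\<^bsub>M\<^esub> i (inv\<^bsub>H\<^esub> \<Gamma> y a)"
    by (simp add: right section_lie)
  also have "\<dots> = i (inv\<^bsub>H\<^esub> \<Gamma> y a) \<otimes>\<^bsub>M\<^esub> (i (\<Gamma> x b) \<otimes>\<^bsub>M\<^esub> (i (h (x, y)) \<otimes>\<^bsub>M\<^esub> t (x \<star>\<^bsub>K\<^esub> y)))"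
    by (rule incl_central) simp_all
  also have "\<dots> = i (inv\<^bsub>H\<^esub> \<Gamma> y a \<otimes>\<^bsub>H\<^esub> \<Gamma> x b \<otimes>\<^bsub>H\<^esub> h (x, y)) \<otimes>\<^bsub>M\<^esub> t (x \<star>\<^bsub>K\<^esub> y)"
    by (simp add: M.m_assoc del: i.hom_inv)
  also have "inv\<^bsub>H\<^esub> \<Gamma> y a \<otimes>\<^bsub>H\<^esub> \<Gamma> x b = \<Gamma> x b \<otimes>\<^bsub>H\<^esub> inv\<^bsub>H\<^esub> \<Gamma> y a"
    by (rule H.m_comm) simp_all
  finally show ?thesis
    by (simp add: combine_eq)
qed

lemma combine_bij: "bij_betw combine (carrier G) (carrier M)"
proof (rule bij_betw_imageI)
  show "inj_on combine (carrier G)"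
  proof (rule inj_onI; clarsimp)
    fix a x b y assume in_HK: "a \<in> carrier H" "x \<in> carrier K" "b \<in> carrier H" "y \<in> carrier K"
      and eq: "combine (a, x) = combine (b, y)"
    have "x = y"
      using in_HK proj_combine[of a x] proj_combine[of b y] eq by simp
    moreover have "a = b"
      using in_HK eq \<open>x = y\<close> by (auto simp: combine_def intro: incl_inj)
    ultimately show "a = b \<and> x = y" by simp
  qed
  have "u \<in> combine ` carrier G" if u: "u \<in> carrier M" for u
  proof
    \<comment> \<open>Dividing \<open>u\<close> by the section value over its projection lands in
      the kernel, which is the image of H.\<close>
    let ?v = "u \<otimes>\<^bsub>M\<^esub> inv\<^bsub>M\<^esub> t (proj E u)"
    have "i (to_kernel H E ?v) = ?v" "to_kernel H E ?v \<in> carrier H"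
      using u by (simp_all add: incl_to_kernel)
    then show "u = combine (to_kernel H E ?v, proj E u)" "(to_kernel H E ?v, proj E u) \<in> carrier G"
      using u by (simp_all add: combine_def M.m_assoc)
  qed
  then show "combine ` carrier G = carrier M" by auto
qed

lemma mult_lie_algebra_G: "mult_lie_algebra G"
  by (rule mult_lie_algebra_transport[OF M.mult_lie_algebra_axioms combine_bij])
    (auto simp: combine_mult combine_lie simp del: twisted_simps(3,4), auto simp: combine_def)

lemma section_cocycle: "is_cocycle H K (f, h, \<Gamma>)"
  by (rule cocycle_if_mult_lie_algebra[OF mult_lie_algebra_G])

lemma twisted_equiv: "equiv_extension H (twisted_extension H K (f, h, \<Gamma>)) E"
  unfolding equiv_extension_def
proof (rule bexI[of _ combine])
  show "combine \<in> mlie_iso (middle (twisted_extension H K (f, h, \<Gamma>))) M"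
    using combine_bij
    by (auto simp: twisted_extension_def mlie_iso_def mlie_hom_def hom_def combine_mult combine_lie
        simp del: twisted_simps(3,4))
qed (auto simp: twisted_extension_def, auto simp: combine_def)

lemma shifted_section:
  assumes g: "g \<in> carrier K \<rightarrow> carrier H" "g \<one>\<^bsub>K\<^esub> = \<one>\<^bsub>H\<^esub>"
  defines "s \<equiv> \<lambda>x. combine (g x, x)"
  shows "is_section K E s"
    and "section_f H K E s = (\<lambda>p \<in> carrier K \<times> carrier K. coboundary_f H K g p \<otimes>\<^bsub>H\<^esub> f p)"
    and "section_h H K E s = (\<lambda>p \<in> carrier K \<times> carrier K. coboundary_h H K \<Gamma> g p \<otimes>\<^bsub>H\<^esub> h p)"
proof -
  have [simp]: "\<And>x. x \<in> carrier K \<Longrightarrow> g x \<in> carrier H"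
    using g by auto
  show s: "is_section K E s"
    using g by (auto simp: is_section_def s_def) (simp add: combine_def)
  interpret s: sectioned_extension H K \<Gamma> E s
    by unfold_locales (fact E s)+
  \<comment> \<open>The change of coordinates from \<open>t\<close> to \<open>s\<close>. Used over
    the product and over the bracket of two elements, it supplies the inverse factor in each
    coboundary.\<close>
  have s_combine: "combine (c, x) = i (c \<otimes>\<^bsub>H\<^esub> inv\<^bsub>H\<^esub> g x) \<otimes>\<^bsub>M\<^esub> s x"
    if "c \<in> carrier H" "x \<in> carrier K" for c x
    using that by (simp add: s_def combine_def M.m_assoc H.m_assoc del: i.hom_inv flip: i.hom_mult M.m_assoc[of "i _" "i _"])
  show "section_f H K E s = (\<lambda>p \<in> carrier K \<times> carrier K. coboundary_f H K g p \<otimes>\<^bsub>H\<^esub> f p)"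
  proof (rule extensionalityI[OF _ restrict_extensional]; clarsimp?)
    show "section_f H K E s \<in> extensional (carrier K \<times> carrier K)"
      using s.section_f_type by (simp add: PiE_def)
    fix x y assume [simp]: "x \<in> carrier K" "y \<in> carrier K"
    have "s x \<otimes>\<^bsub>M\<^esub> s y = combine ((g x, x) \<otimes>\<^bsub>G\<^esub> (g y, y))"
      by (simp add: s_def combine_mult del: twisted_simps(3))
    then show "section_f H K E s (x, y) = coboundary_f H K g (x, y) \<otimes>\<^bsub>H\<^esub> f (x, y)"
      by (intro s.section_f_unique) (simp_all add: coboundary_f_def s_combine H.m_ac)
  qed
  show "section_h H K E s = (\<lambda>p \<in> carrier K \<times> carrier K. coboundary_h H K \<Gamma> g p \<otimes>\<^bsub>H\<^esub> h p)"
  proof (rule extensionalityI[OF _ restrict_extensional]; clarsimp?)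
    show "section_h H K E s \<in> extensional (carrier K \<times> carrier K)"
      using s.section_h_type by (simp add: PiE_def)
    fix x y assume [simp]: "x \<in> carrier K" "y \<in> carrier K"
    have "s x \<star>\<^bsub>M\<^esub> s y = combine ((g x, x) \<star>\<^bsub>G\<^esub> (g y, y))"
      by (simp add: s_def combine_lie del: twisted_simps(4))
    then show "section_h H K E s (x, y) = coboundary_h H K \<Gamma> g (x, y) \<otimes>\<^bsub>H\<^esub> h (x, y)"
      by (intro s.section_h_unique) (simp_all add: coboundary_h_def s_combine H.m_ac)
  qed
qed

text \<open>Two sections agree after projection, so their quotient takes values in the kernel and
  defines \<open>g\<close>. Every change of section is therefore of the kind computed in
  \<open>shifted_section\<close>.\<close>

lemma section_is_shifted:
  assumes s: "is_section K E s"
  obtains g where "g \<in> carrier K \<rightarrow> carrier H" "g \<one>\<^bsub>K\<^esub> = \<one>\<^bsub>H\<^esub>"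
    "\<And>x. x \<in> carrier K \<Longrightarrow> s x = combine (g x, x)"
proof -
  interpret s: sectioned_extension H K \<Gamma> E s
    by unfold_locales (fact E s)+
  define g where "g x = to_kernel H E (s x \<otimes>\<^bsub>M\<^esub> inv\<^bsub>M\<^esub> t x)" for x
  have g: "i (g x) = s x \<otimes>\<^bsub>M\<^esub> inv\<^bsub>M\<^esub> t x" "g x \<in> carrier H" if "x \<in> carrier K" for x
    using that by (simp_all add: g_def incl_to_kernel)
  show thesis
  proof
    show "g \<one>\<^bsub>K\<^esub> = \<one>\<^bsub>H\<^esub>"
      by (rule incl_inj) (simp_all add: g)
    show "s x = combine (g x, x)" if "x \<in> carrier K" for x
      using that by (simp add: combine_eq g M.m_assoc)
  qed (simp add: g)
qed

end

section \<open>The center extension built from a cocycle\<close>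

context normalized_cochain
begin

context
  assumes cocycle: "is_cocycle H K (f, h, \<Gamma>)"
begin

interpretation G: mult_lie_algebra G
  by (rule mult_lie_algebra_if_cocycle[OF cocycle])

abbreviation (input) "T \<equiv> twisted_extension H K (f, h, \<Gamma>)"

lemma twisted_extension_simps:
  "middle T = G" "incl T a = (a, \<one>\<^bsub>K\<^esub>)" "proj T = snd"
  by (simp_all add: twisted_extension_def)

lemma cocycle_h_normalized: "x \<in> carrier K \<Longrightarrow> h (x, \<one>\<^bsub>K\<^esub>) = \<one>\<^bsub>H\<^esub>"
  using cocycle by (simp add: is_cocycle_def)

text \<open>On pairs with second component the unit, \<Gamma>, \<open>f\<close> and \<open>h\<close>
  are all trivial, so the embedding respects both operations. Centrality holds because H is abelian
  and \<open>f\<close> is trivial when one argument is the unit.\<close>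

lemma twisted_is_center_extension: "is_center_extension H K T"
proof -
  have "snd \<in> mlie_hom G K"
    by (auto simp: mlie_hom_def hom_def)
  moreover have "incl T \<in> mlie_hom H G"
    using trivial
    by (auto simp: mlie_hom_def hom_def twisted_extension_simps trivial_mlie_def cocycle_h_normalized)
  moreover have "incl T ` carrier H = kernel G K snd"
    by (auto simp: kernel_def twisted_extension_simps)
  moreover have "inj_on (incl T) (carrier H)"
    by (auto simp: inj_on_def twisted_extension_simps)
  moreover have "snd ` carrier G = carrier K"
    by (auto simp: image_iff intro!: bexI[of _ "\<one>\<^bsub>H\<^esub>"])
  ultimately show ?thesis
    using G.mult_lie_algebra_axioms
    by (auto simp: is_center_extension_def is_extension_def twisted_extension_simps(1,3))
      (simp add: twisted_extension_simps H.m_comm)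
qed

lemma twisted_section: "is_section K T (\<lambda>x. (\<one>\<^bsub>H\<^esub>, x))"
  by (simp add: is_section_def twisted_extension_simps)

lemma twisted_in_center_extensions: "T \<in> center_extensions H K \<Gamma>"
proof -
  have "Gamma_ext H K T x = \<Gamma> x" if x: "x \<in> carrier K" for x
  \<comment> \<open>Membership in \<open>center_extensions\<close> asks for equality of functions on
    the whole type. Both sides are extensional, so agreement on the carrier of H is enough.\<close>
  proof (rule extensionalityI[OF _ \<Gamma>_extensional[OF x]])
    have eq: "Gamma_ext H K T x = section_action H T (\<lambda>x. (\<one>\<^bsub>H\<^esub>, x)) x"
      by (rule Gamma_ext_eq[OF twisted_is_center_extension K.is_group H.is_group trivial twisted_section x])
    then show "Gamma_ext H K T x \<in> extensional (carrier H)"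
      by (simp add: section_action_def)
    fix a assume a: "a \<in> carrier H"
    have "to_kernel H T (\<Gamma> x a, \<one>\<^bsub>K\<^esub>) = \<Gamma> x a"
      unfolding to_kernel_def using x a
      by (intro inv_into_f_eq) (auto simp: inj_on_def twisted_extension_simps)
    then show "Gamma_ext H K T x a = \<Gamma> x a"
      using x a by (simp add: eq section_action_def twisted_extension_simps cocycle_h_normalized)
  qed
  then show ?thesis
    by (simp add: center_extensions_def twisted_is_center_extension)
qed

text \<open>The obvious section returns the given cocycle itself, not just a cohomologous one; this
  yields surjectivity of the correspondence.\<close>

lemma section_cocycle_twisted:
  "section_f H K T (\<lambda>x. (\<one>\<^bsub>H\<^esub>, x)) = f" "section_h H K T (\<lambda>x. (\<one>\<^bsub>H\<^esub>, x)) = h"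
proof -
  interpret T: sectioned_extension H K \<Gamma> T "\<lambda>x. (\<one>\<^bsub>H\<^esub>, x)"
    by unfold_locales (fact twisted_in_center_extensions twisted_section)+
  show "section_f H K T (\<lambda>x. (\<one>\<^bsub>H\<^esub>, x)) = f"
    by (rule PiE_ext[OF T.section_f_type f_type])
      (auto intro!: T.section_f_unique simp: twisted_extension_simps)
  show "section_h H K T (\<lambda>x. (\<one>\<^bsub>H\<^esub>, x)) = h"
    by (rule PiE_ext[OF T.section_h_type h_type])
      (auto intro!: T.section_h_unique simp: twisted_extension_simps)
qed

end

end

section \<open>Cosets of coboundaries as orbits of normalized maps\<close>

context center_data
begin

definition normalized_maps :: "('k \<Rightarrow> 'h) set" where
  "normalized_maps = {g \<in> carrier K \<rightarrow> carrier H. g \<one>\<^bsub>K\<^esub> = \<one>\<^bsub>H\<^esub>}"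

text \<open>Normalized maps act on triplets through their coboundaries. This is also the effect on
  the cochains of replacing a section \<open>t\<close> by its product with \<open>g\<close>, so
  cosets and changes of section are described by the same operation.\<close>

definition shift :: "('k \<Rightarrow> 'h) \<Rightarrow> ('h, 'k) triplet \<Rightarrow> ('h, 'k) triplet" where
  "shift g = (\<lambda>(f, h, _).
     ((\<lambda>p \<in> carrier K \<times> carrier K. coboundary_f H K g p \<otimes>\<^bsub>H\<^esub> f p),
      (\<lambda>p \<in> carrier K \<times> carrier K. coboundary_h H K \<Gamma> g p \<otimes>\<^bsub>H\<^esub> h p), \<Gamma>))"

lemma cocycle_normalized_cochain:
  "is_cocycle H K (f, h, \<Gamma>) \<Longrightarrow> normalized_cochain H K \<Gamma> f h"
  by unfold_locales (auto simp: is_cocycle_def)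

lemma coset_eq: "B2 H K \<Gamma> #>\<^bsub>Z2 H K \<Gamma>\<^esub> c = (\<lambda>g. shift g c) ` normalized_maps"
proof -
  have "B2 H K \<Gamma> = (\<lambda>g. (coboundary_f H K g, coboundary_h H K \<Gamma> g, \<Gamma>)) ` normalized_maps"
    by (auto simp: B2_def normalized_maps_def)
  then show ?thesis
    by (cases c) (auto simp: r_coset_def Z2_def shift_def)
qed

lemma normalized_maps_closed:
  "(\<lambda>x. \<one>\<^bsub>H\<^esub>) \<in> normalized_maps"
  "g \<in> normalized_maps \<Longrightarrow> (\<lambda>x. inv\<^bsub>H\<^esub> g x) \<in> normalized_maps"
  "\<lbrakk>g \<in> normalized_maps; g' \<in> normalized_maps\<rbrakk> \<Longrightarrow> (\<lambda>x. g x \<otimes>\<^bsub>H\<^esub> g' x) \<in> normalized_maps"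
  by (auto simp: normalized_maps_def)

context
  fixes f h
  assumes f_type: "f \<in> carrier K \<times> carrier K \<rightarrow>\<^sub>E carrier H"
    and h_type: "h \<in> carrier K \<times> carrier K \<rightarrow>\<^sub>E carrier H"
begin

lemma shift_trivial:
  assumes "\<And>x. x \<in> carrier K \<Longrightarrow> g x = \<one>\<^bsub>H\<^esub>"
  shows "shift g (f, h, \<Gamma>) = (f, h, \<Gamma>)"
proof -
  have "(\<lambda>p \<in> carrier K \<times> carrier K. d p \<otimes>\<^bsub>H\<^esub> u p) = u"
    if "u \<in> carrier K \<times> carrier K \<rightarrow>\<^sub>E carrier H"
      "\<And>x y. \<lbrakk>x \<in> carrier K; y \<in> carrier K\<rbrakk> \<Longrightarrow> d (x, y) = \<one>\<^bsub>H\<^esub>" for d u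
    using that by (intro extensionalityI[OF restrict_extensional]) (auto simp: PiE_def Pi_iff)
  then show ?thesis
    using assms f_type h_type by (simp add: shift_def coboundary_f_def coboundary_h_def)
qed

text \<open>Coboundaries are multiplicative in \<open>g\<close>, since H is abelian and each
  \<open>\<Gamma> x\<close> is an endomorphism.\<close>

lemma shift_shift:
  assumes "g \<in> normalized_maps" "g' \<in> normalized_maps"
  shows "shift g' (shift g (f, h, \<Gamma>)) = shift (\<lambda>x. g' x \<otimes>\<^bsub>H\<^esub> g x) (f, h, \<Gamma>)"
proof -
  have "f (x, y) \<in> carrier H" "h (x, y) \<in> carrier H" if "x \<in> carrier K" "y \<in> carrier K" for x y
    using f_type h_type that by auto
  moreover have "g x \<in> carrier H" "g' x \<in> carrier H" if "x \<in> carrier K" for x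
    using assms that by (auto simp: normalized_maps_def)
  ultimately show ?thesis
    by (auto simp: shift_def coboundary_f_def coboundary_h_def H.inv_mult H.m_ac intro!: restrict_ext)
qed

lemma coset_shift:
  assumes g: "g \<in> normalized_maps"
  shows "B2 H K \<Gamma> #>\<^bsub>Z2 H K \<Gamma>\<^esub> shift g (f, h, \<Gamma>) = B2 H K \<Gamma> #>\<^bsub>Z2 H K \<Gamma>\<^esub> (f, h, \<Gamma>)"
  unfolding coset_eq
proof (intro equalityI image_subsetI)
  fix g' assume g': "g' \<in> normalized_maps"
  show "shift g' (shift g (f, h, \<Gamma>)) \<in> (\<lambda>g. shift g (f, h, \<Gamma>)) ` normalized_maps"
    using g g' by (auto simp: shift_shift normalized_maps_closed)
next
  fix g' assume g': "g' \<in> normalized_maps"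
  have "g x \<in> carrier H" "g' x \<in> carrier H" if "x \<in> carrier K" for x
    using g g' that by (auto simp: normalized_maps_def)
  \<comment> \<open>Factor \<open>g'\<close> through \<open>g\<close>, so that the action law
    exhibits the point in the orbit of the shifted triplet. The two maps agree only on the carrier
    of K, which is all that \<open>shift\<close> sees.\<close>
  then have "shift g' (f, h, \<Gamma>) = shift (\<lambda>x. (g' x \<otimes>\<^bsub>H\<^esub> inv\<^bsub>H\<^esub> g x) \<otimes>\<^bsub>H\<^esub> g x) (f, h, \<Gamma>)"
    by (auto simp: shift_def coboundary_f_def coboundary_h_def H.m_assoc intro!: restrict_ext)
  also have "\<dots> = shift (\<lambda>x. g' x \<otimes>\<^bsub>H\<^esub> inv\<^bsub>H\<^esub> g x) (shift g (f, h, \<Gamma>))"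
    using g g' by (simp add: shift_shift normalized_maps_closed)
  finally show "shift g' (f, h, \<Gamma>) \<in> (\<lambda>g'. shift g' (shift g (f, h, \<Gamma>))) ` normalized_maps"
    using g g' by (auto simp: normalized_maps_closed)
qed

end

section \<open>Equivalence classes of extensions and cohomology classes\<close>

abbreviation section_triplet where
  "section_triplet E t \<equiv> (section_f H K E t, section_h H K E t, \<Gamma>)"

lemma shifted_triplet:
  assumes "E \<in> center_extensions H K \<Gamma>" "is_section K E t" "g \<in> normalized_maps"
  obtains s where "is_section K E s" "section_triplet E s = shift g (section_triplet E t)"
proof -
  interpret sectioned_extension H K \<Gamma> E t
    by unfold_locales (fact assms)+
  have g: "g \<in> carrier K \<rightarrow> carrier H" "g \<one>\<^bsub>K\<^esub> = \<one>\<^bsub>H\<^esub>"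
    using assms(3) by (simp_all add: normalized_maps_def)
  show thesis
    using that[OF shifted_section(1)[OF g]] shifted_section(2,3)[OF g]
    by (simp add: shift_def)
qed

lemma section_class_unique:
  assumes E: "E \<in> center_extensions H K \<Gamma>" and t: "is_section K E t" and s: "is_section K E s"
  shows "section_class H K \<Gamma> E s = section_class H K \<Gamma> E t"
proof -
  interpret sectioned_extension H K \<Gamma> E t
    by unfold_locales (fact E t)+
  obtain g where g: "g \<in> carrier K \<rightarrow> carrier H" "g \<one>\<^bsub>K\<^esub> = \<one>\<^bsub>H\<^esub>"
    and s_eq: "\<And>x. x \<in> carrier K \<Longrightarrow> s x = combine (g x, x)"
    using section_is_shifted[OF s] by blast
  \<comment> \<open>Sections are not extensional, so \<open>s\<close> need not equal the shifted
    section off the carrier; the cochains depend only on values on the carrier.\<close>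
  have "section_triplet E s = section_triplet E (\<lambda>x. combine (g x, x))"
    using s_eq by (auto simp: section_f_def section_h_def intro!: restrict_ext)
  also have "\<dots> = shift g (section_triplet E t)"
    using shifted_section(2,3)[OF g] by (simp add: shift_def)
  finally show ?thesis
    using g coset_shift[OF section_f_type section_h_type]
    by (simp add: section_class_def normalized_maps_def)
qed

text \<open>Both extensions are equivalent to the twisted extension of their common triplet.\<close>

lemma equiv_extension_if_triplets_eq:
  assumes E1: "E1 \<in> center_extensions H K \<Gamma>" "is_section K E1 t1"
    and E2: "E2 \<in> center_extensions H K \<Gamma>" "is_section K E2 t2"
    and eq: "section_triplet E1 t1 = section_triplet E2 t2"
  shows "equiv_extension H E1 E2"
proof -
  interpret E1: sectioned_extension H K \<Gamma> E1 t1
    by unfold_locales (fact E1)+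
  interpret E2: sectioned_extension H K \<Gamma> E2 t2
    by unfold_locales (fact E2)+
  have "is_extension H K (twisted_extension H K (section_triplet E1 t1))"
    using E1.twisted_is_center_extension[OF E1.section_cocycle] by (simp add: is_center_extension_def)
  then have "equiv_extension H E1 (twisted_extension H K (section_triplet E1 t1))"
    by (rule equiv_extension_sym) (rule E1.twisted_equiv)
  then show ?thesis
    using E2.twisted_equiv unfolding eq by (rule equiv_extension_trans)
qed

text \<open>From left to right, a transported section has the same cochains, and the class does not
  depend on the section. Conversely, equal classes mean that the triplets differ by a coboundary,
  which a change of section in \<open>E2\<close> absorbs. The middle terms may have different
  types.\<close>

lemma equiv_extension_iff:
  assumes E1: "E1 \<in> center_extensions H K \<Gamma>" "is_section K E1 t1"
    and E2: "E2 \<in> center_extensions H K \<Gamma>" "is_section K E2 t2"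
  shows "equiv_extension H E1 E2 \<longleftrightarrow> section_class H K \<Gamma> E1 t1 = section_class H K \<Gamma> E2 t2"
proof
  interpret E1: sectioned_extension H K \<Gamma> E1 t1
    by unfold_locales (fact E1)+
  interpret E2: sectioned_extension H K \<Gamma> E2 t2
    by unfold_locales (fact E2)+
  {
    assume "equiv_extension H E1 E2"
    then obtain \<phi> where \<phi>: "\<phi> \<in> mlie_iso (middle E1) (middle E2)"
      and incl: "\<And>a. a \<in> carrier H \<Longrightarrow> \<phi> (incl E1 a) = incl E2 a"
      and proj: "\<And>u. u \<in> carrier (middle E1) \<Longrightarrow> proj E2 (\<phi> u) = proj E1 u"
      by (auto simp: equiv_extension_def)
    interpret \<phi>: group_hom "middle E1" "middle E2" \<phi>
      using \<phi> by unfold_locales (simp add: mlie_iso_def mlie_hom_def)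
    have lie: "\<phi> (u \<star>\<^bsub>middle E1\<^esub> v) = \<phi> u \<star>\<^bsub>middle E2\<^esub> \<phi> v"
      if "u \<in> carrier (middle E1)" "v \<in> carrier (middle E1)" for u v
      using \<phi> that by (simp add: mlie_iso_def mlie_hom_def)
    have s: "is_section K E2 (\<phi> \<circ> t1)"
      by (simp add: is_section_def proj)
    interpret s: sectioned_extension H K \<Gamma> E2 "\<phi> \<circ> t1"
      by unfold_locales (fact E2 s)+
    have "section_f H K E2 (\<phi> \<circ> t1) = section_f H K E1 t1"
    proof (rule PiE_ext[OF s.section_f_type E1.section_f_type], clarify)
      fix x y assume "x \<in> carrier K" "y \<in> carrier K"
      then show "section_f H K E2 (\<phi> \<circ> t1) (x, y) = section_f H K E1 t1 (x, y)"
        using arg_cong[OF E1.section_mult[of x y], of \<phi>] by (intro s.section_f_unique) (simp_all add: incl)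
    qed
    moreover have "section_h H K E2 (\<phi> \<circ> t1) = section_h H K E1 t1"
    proof (rule PiE_ext[OF s.section_h_type E1.section_h_type], clarify)
      fix x y assume "x \<in> carrier K" "y \<in> carrier K"
      then show "section_h H K E2 (\<phi> \<circ> t1) (x, y) = section_h H K E1 t1 (x, y)"
        using arg_cong[OF E1.section_lie[of x y], of \<phi>] by (intro s.section_h_unique) (simp_all add: incl lie)
    qed
    ultimately have "section_class H K \<Gamma> E1 t1 = section_class H K \<Gamma> E2 (\<phi> \<circ> t1)"
      by (simp add: section_class_def)
    then show "section_class H K \<Gamma> E1 t1 = section_class H K \<Gamma> E2 t2"
      using section_class_unique[OF E2 s] by simp
  next
    assume eq: "section_class H K \<Gamma> E1 t1 = section_class H K \<Gamma> E2 t2"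
    \<comment> \<open>The constant map to the unit puts a triplet in its own coset. Transferred
      along \<open>eq\<close>, this membership produces the \<open>g\<close> relating the two
      triplets.\<close>
    have "section_triplet E1 t1 \<in> section_class H K \<Gamma> E1 t1"
      unfolding section_class_def coset_eq
      using shift_trivial[OF E1.section_f_type E1.section_h_type]
      by (intro image_eqI[OF _ normalized_maps_closed(1)]) simp
    then obtain g where g: "g \<in> normalized_maps" "section_triplet E1 t1 = shift g (section_triplet E2 t2)"
      unfolding eq unfolding section_class_def coset_eq by blast
    obtain s where "is_section K E2 s" "section_triplet E2 s = shift g (section_triplet E2 t2)"
      using shifted_triplet[OF E2 g(1)] by blast
    then show "equiv_extension H E1 E2"
      using equiv_extension_if_triplets_eq[OF E1 E2(1)] g(2) by simp
  }
qed

lemma section_class_in_H2: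
  assumes "E \<in> center_extensions H K \<Gamma>" "is_section K E t"
  shows "section_class H K \<Gamma> E t \<in> carrier (H2 H K \<Gamma>)"
proof -
  interpret sectioned_extension H K \<Gamma> E t
    by unfold_locales (fact assms)+
  show ?thesis
    using section_cocycle
    by (auto simp: H2_def FactGroup_def RCOSETS_def section_class_def Z2_def)
qed

lemma H2_realized:
  assumes "X \<in> carrier (H2 H K \<Gamma>)"
  obtains E t where "(E :: ('h, 'h \<times> 'k, 'k) mlie_extension) \<in> center_extensions H K \<Gamma>"
    "is_section K E t" "section_class H K \<Gamma> E t = X"
proof -
  obtain f h where fh: "is_cocycle H K (f, h, \<Gamma>)" "X = B2 H K \<Gamma> #>\<^bsub>Z2 H K \<Gamma>\<^esub> (f, h, \<Gamma>)"
    using assms by (auto simp: H2_def FactGroup_def RCOSETS_def Z2_def)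
  interpret normalized_cochain H K \<Gamma> f h
    by (rule cocycle_normalized_cochain[OF fh(1)])
  show thesis
    using that[OF twisted_in_center_extensions twisted_section] fh
    by (simp add: section_class_def section_cocycle_twisted)
qed

lemma ex_section: "E \<in> center_extensions H K \<Gamma> \<Longrightarrow> \<exists>t. is_section K E t"
  using section_exists[of H K E] K.is_group by (simp add: center_extensions_def is_center_extension_def)

text \<open>The class of \<open>E\<close> is also realized on H x K, and equal classes force
  equivalence. Thus the type of pairs represents extensions whose middle term lives in any
  type.\<close>

lemma ex_twisted_equiv:
  fixes E :: "('h, 'g, 'k) mlie_extension"
  assumes E: "E \<in> center_extensions H K \<Gamma>"
  obtains E' :: "('h, 'h \<times> 'k, 'k) mlie_extension"
  where "E' \<in> center_extensions H K \<Gamma>" "equiv_extension H E E'"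
proof -
  obtain t where t: "is_section K E t" using ex_section[OF E] by blast
  obtain E' t' where "(E' :: ('h, 'h \<times> 'k, 'k) mlie_extension) \<in> center_extensions H K \<Gamma>"
    "is_section K E' t'" "section_class H K \<Gamma> E' t' = section_class H K \<Gamma> E t"
    by (rule H2_realized[OF section_class_in_H2[OF E t]])
  then show thesis
    using that equiv_extension_iff[OF E t] by metis
qed

lemma equiv_extension_rel: "equiv (center_extensions H K \<Gamma>) (extension_rel H K \<Gamma>)"
proof (rule equivI)
  show "refl_on (center_extensions H K \<Gamma>) (extension_rel H K \<Gamma>)"
    by (auto simp: refl_on_def extension_rel_def equiv_extension_refl)
  show "sym (extension_rel H K \<Gamma>)"
    by (auto simp: sym_def extension_rel_def center_extensions_def is_center_extension_def
        intro: equiv_extension_sym)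
  show "trans (extension_rel H K \<Gamma>)"
    by (auto simp: trans_def extension_rel_def intro: equiv_extension_trans)
qed (auto simp: extension_rel_def)

definition extension_class :: "('h, 'g, 'k) mlie_extension \<Rightarrow> ('h, 'k) triplet set" where
  "extension_class E = section_class H K \<Gamma> E (SOME t. is_section K E t)"

lemma extension_class_eq:
  assumes "E \<in> center_extensions H K \<Gamma>" "is_section K E t"
  shows "extension_class E = section_class H K \<Gamma> E t"
  unfolding extension_class_def
  using assms by (intro section_class_unique) (auto intro: someI_ex[OF ex_section])

lemma equiv_extension_iff_class:
  assumes "E1 \<in> center_extensions H K \<Gamma>" "E2 \<in> center_extensions H K \<Gamma>"
  shows "equiv_extension H E1 E2 \<longleftrightarrow> extension_class E1 = extension_class E2"
  using ex_section[OF assms(1)] ex_section[OF assms(2)] assms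
  by (auto simp: equiv_extension_iff extension_class_eq)

end

theorem theorem2p11:
  fixes H :: "('h, 'm) mlie_scheme" and K :: "('k, 'n) mlie_scheme" and \<Gamma> :: "'k \<Rightarrow> 'h \<Rightarrow> 'h"
  assumes "comm_group H" and "mult_lie_algebra H" and "trivial_mlie H"
    and "mult_lie_algebra K"
    and "\<Gamma> \<in> mlie_hom K (End_mlie H)"
  shows "\<exists>\<Phi>.
     bij_betw \<Phi> (CExt H K \<Gamma> :: ('h, 'h \<times> 'k, 'k) mlie_extension set set) (carrier (H2 H K \<Gamma>)) \<and>
     (\<forall>E \<in> center_extensions H K \<Gamma>. \<forall>t. is_section K E t \<longrightarrow>
        \<Phi> (extension_rel H K \<Gamma> `` {E}) = section_class H K \<Gamma> E t) \<and>
     (\<forall>E \<in> (center_extensions H K \<Gamma> :: ('h, 'g, 'k) mlie_extension set).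
        \<exists>E' \<in> center_extensions H K \<Gamma>. equiv_extension H E E' \<and>
          (\<forall>t. is_section K E t \<longrightarrow>
             \<Phi> (extension_rel H K \<Gamma> `` {E'}) = section_class H K \<Gamma> E t))"
proof -
  interpret K: mult_lie_algebra K by fact
  interpret H: comm_group H by fact
  interpret center_data H K \<Gamma>
    by unfold_locales (fact assms)+
  let ?C = "center_extensions H K \<Gamma> :: ('h, 'h \<times> 'k, 'k) mlie_extension set"
  let ?R = "extension_rel H K \<Gamma> :: ('h, 'h \<times> 'k, 'k) mlie_extension rel"
  \<comment> \<open>The value at an arbitrary representative. Equivalence of extensions is the same
    as equality of their classes: one implication makes the choice harmless, the other gives
    injectivity.\<close>
  define \<Phi> where "\<Phi> X = extension_class (SOME E :: ('h, 'h \<times> 'k, 'k) mlie_extension. E \<in> X)" for X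
  have \<Phi>: "\<Phi> (?R `` {E}) = extension_class E" if E: "E \<in> ?C" for E
  proof -
    have "E \<in> ?R `` {E}"
      using E equiv_class_self[OF equiv_extension_rel] by blast
    moreover define E' where "E' = (SOME E'. E' \<in> ?R `` {E})"
    ultimately have "(E, E') \<in> ?R"
      by (metis Image_singleton_iff someI)
    then have "extension_class E = extension_class E'"
      using equiv_extension_iff_class[of E E'] by (auto simp: extension_rel_def)
    then show ?thesis
      by (simp add: \<Phi>_def E'_def)
  qed
  have "inj_on \<Phi> (CExt H K \<Gamma>)"
  proof (rule inj_onI)
    fix X Y assume "X \<in> CExt H K \<Gamma>" "Y \<in> CExt H K \<Gamma>" and eq: "\<Phi> X = \<Phi> Y"
    then obtain E F where EF: "E \<in> ?C" "F \<in> ?C" "X = ?R `` {E}" "Y = ?R `` {F}"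
      unfolding CExt_def by (metis quotientE)
    then have "equiv_extension H E F"
      using eq by (simp add: \<Phi> equiv_extension_iff_class)
    then have "(E, F) \<in> ?R"
      using EF by (simp add: extension_rel_def)
    then show "X = Y"
      using EF(3,4) equiv_class_eq[OF equiv_extension_rel] by simp
  qed
  moreover have "\<Phi> ` CExt H K \<Gamma> = carrier (H2 H K \<Gamma>)"
  proof (intro equalityI subsetI)
    fix Z assume "Z \<in> \<Phi> ` CExt H K \<Gamma>"
    then obtain E where E: "E \<in> ?C" "Z = extension_class E"
      unfolding CExt_def by (auto elim!: quotientE simp: \<Phi>)
    then show "Z \<in> carrier (H2 H K \<Gamma>)"
      using ex_section section_class_in_H2 extension_class_eq by metis
  next
    fix Z assume "Z \<in> carrier (H2 H K \<Gamma>)"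
    then obtain E t where E: "E \<in> ?C" "is_section K E t" "section_class H K \<Gamma> E t = Z"
      by (rule H2_realized)
    then have "Z = \<Phi> (?R `` {E})"
      by (simp add: \<Phi> extension_class_eq)
    then show "Z \<in> \<Phi> ` CExt H K \<Gamma>"
      unfolding CExt_def using E by (auto intro: quotientI)
  qed
  ultimately have "bij_betw \<Phi> (CExt H K \<Gamma>) (carrier (H2 H K \<Gamma>))"
    by (simp add: bij_betw_def)
  \<comment> \<open>Here \<open>E\<close> has a middle term in an unrelated type. It is replaced by
    an equivalent extension on H x K with the same class, to which \<Phi> applies.\<close>
  moreover have "\<exists>E' \<in> ?C. equiv_extension H E E' \<and>
      (\<forall>t. is_section K E t \<longrightarrow> \<Phi> (?R `` {E'}) = section_class H K \<Gamma> E t)"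
    if E: "E \<in> center_extensions H K \<Gamma>" for E :: "('h, 'g, 'k) mlie_extension"
  proof -
    obtain E' where E': "E' \<in> ?C" "equiv_extension H E E'"
      by (rule ex_twisted_equiv[OF E])
    then have "extension_class E = extension_class E'"
      using E equiv_extension_iff_class by blast
    then show ?thesis
      using E E' by (metis \<Phi> extension_class_eq)
  qed
  ultimately show ?thesis
    by (intro exI[of _ \<Phi>]) (simp add: \<Phi> extension_class_eq)
qed

end
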